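(* Let $1 < p < \infty$ and let $Q_0 \subset \mathbb{R}$ be a bounded interval. Then there is a function $g : Q_0 \to \mathbb{R}$ such that $g \in JN_p(Q_0) \setminus VJN_p(Q_0)$.
   Context: For an integrable function $h$ on an interval $J$ write $h_J := \frac{1}{|J|}\int_J h$. For a bounded interval $Q_0 \subset \mathbb{R}$ and $1<p<\infty$, a function $h$ belongs to $JN_p(Q_0)$ if $h \in L^1(Q_0)$ and there is a constant $K<\infty$ such that $\sum_{i=1}^\infty |Q_i| \left( \frac{1}{|Q_i|}\int_{Q_i} |h - h_{Q_i}| \right)^p \leq K^p$ for all countable collections of pairwise disjoint intervals $(Q_i)_{i=1}^\infty$ contained in $Q_0$. A function $h$ belongs to $VJN_p(Q_0)$ if $h \in JN_p(Q_0)$ and $\lim_{a\to 0} \sup \sum_{i=1}^\infty |Q_i| \left( \frac{1}{|Q_i|}\int_{Q_i} |h - h_{Q_i}| \right)^p = 0$, where for each $a>0$ the supremum is over all collections of pairwise disjoint intervals $Q_i \subset Q_0$ each of length at most $a$. *)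

theory Defs
  imports "HOL-Analysis.Analysis"
begin

(* Intervals may be open, closed or half-open, but they are nondegenerate:
   the averages below divide by the length. *)
definition bounded_interval :: "real set \<Rightarrow> bool" where
  "bounded_interval Q \<longleftrightarrow> is_interval Q \<and> bounded Q \<and> 0 < measure lebesgue Q"

definition average :: "(real \<Rightarrow> real) \<Rightarrow> real set \<Rightarrow> real" where
  "average h J = (1 / measure lebesgue J) * (LINT x:J|lebesgue. h x)"

definition mean_oscillation :: "(real \<Rightarrow> real) \<Rightarrow> real set \<Rightarrow> real" where
  "mean_oscillation h Q =
     (1 / measure lebesgue Q) * (LINT x:Q|lebesgue. \<bar>h x - average h Q\<bar>)"

(* A collection is a set of intervals, so finite collections are included. *)
definition interval_collections :: "real set \<Rightarrow> real set set set" where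
  "interval_collections Q0 =
     {F. countable F \<and> disjoint F \<and> (\<forall>Q\<in>F. bounded_interval Q \<and> Q \<subseteq> Q0)}"

(* Valued in ennreal, where the (unconditional) sum of nonnegative terms always exists. *)
definition JN_sum :: "real \<Rightarrow> (real \<Rightarrow> real) \<Rightarrow> real set set \<Rightarrow> ennreal" where
  "JN_sum p h F =
     (\<Sum>\<^sub>\<infinity>Q\<in>F. ennreal (measure lebesgue Q * mean_oscillation h Q powr p))"

(* Functions on Q0 are represented by functions on the reals whose values
   outside Q0 play no role: only integrals over subintervals of Q0 occur. *)
definition JN :: "real \<Rightarrow> real set \<Rightarrow> (real \<Rightarrow> real) set" where
  "JN p Q0 = {h. set_integrable lebesgue Q0 h \<and>
     (\<exists>K\<ge>0. \<forall>F\<in>interval_collections Q0. JN_sum p h F \<le> ennreal (K powr p))}"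

definition VJN :: "real \<Rightarrow> real set \<Rightarrow> (real \<Rightarrow> real) set" where
  "VJN p Q0 = {h \<in> JN p Q0.
     ((\<lambda>a. SUP F\<in>{F \<in> interval_collections Q0. \<forall>Q\<in>F. measure lebesgue Q \<le> a}. JN_sum p h F)
        \<longlongrightarrow> 0) (at_right 0)}"

end

theory Submission
  imports Defs
begin

text \<open>
  Fix a number $D = 2d$ that is large in terms of $p$ and put $H = D^{1/p}$. Starting from
  the real line $S_0$, let $S_{k+1}$ arise from $S_k$ by cutting every component of $S_k$ into
  equal cells (cells of level $k$) and keeping in each cell only a piece, the core, of relative
  length $1/D$ which starts at the midpoint of the cell. The witness is the tower
  $g = \sum_{k \ge 0} H^k 1_{S_{k+1}}$, restricted to $Q_0$.

  The function is not in $VJN_p$: on a cell of level $k$ inside $S_k$ the mean oscillation of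
  $g$ is at least a constant times $H^k$, because $g$ is constant off the core and jumps by $H^k$ on
  most of the core. Such cells fill the set $S_k$, whose density is $D^{-k}$, and
  $H^{kp} D^{-k} = 1$. Hence the level $k$ cells in $Q_0$ give sums that are bounded below
  by a constant independent of $k$, although their length tends to $0$
  (\<open>JN_sum_cells_ge\<close>).

  The function is in $JN_p$ because the levels cannot all be exploited at once. Given an
  interval $Q$, let $k$ be the last level with $Q \subseteq S_k$. If $Q$ meets a core $J$ of
  level $k$, it does so in all of $J$ or in a piece of $J$ that has an endpoint in common with $J$. Since
  every core is surrounded by large gaps, a piece of a cell that begins or ends at a grid
  point contains at most the proportion $2/D$ of core, and this persists through all later
  levels; as $2H/D \le 1/2$, the part of the tower above its constant value on
  $S_k \setminus S_{k+1}$ has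
  integral at most $2 H^k |Q \cap S_{k+1}|$ over $Q$. Convexity of $t \mapsto t^p$ turns this into a bound of
  $|Q|$ times the $p$-th power of the oscillation by a constant times $D^{k+1} |Q \cap S_{k+1}|$
  (\<open>oscillation_le_charge\<close>).

  It remains to sum $D^{k+1} |Q \cap S_{k+1}|$ over disjoint $Q$ with varying $k$. Mass $D^N$
  per unit length, spread over $S_N$, gives each full cell of level $k+1$ inside $S_{k+1}$ the
  mass $D^{k+1}$ times its length. A piece of a core that shares an endpoint with the core
  therefore has the required mass up to a factor $2$ once it contains one full cell of level
  $k+1$; for shorter pieces, mass of density $D^{k+1}$ is added on the first and the
  last of these cells (\<open>charge_ge\<close>). A core of level $k$ consists of $2^{k+1}$ cells of level $k+1$,
  so the added mass is at most $2^{-k}$ per unit length, and the total mass stays bounded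
  uniformly in $N$ (\<open>emeasure_charge_grid_le\<close>).
\<close>

section \<open>Intervals and mean oscillation\<close>

lemma bounded_interval_ends:
  assumes "bounded_interval Q"
  obtains a b where "a < b" "{a<..<b} \<subseteq> Q" "Q \<subseteq> {a..b}"
proof -
  have Q: "is_interval Q" "bounded Q" "0 < measure lebesgue Q"
    using assms by (auto simp: bounded_interval_def)
  then have ne: "Q \<noteq> {}" by auto
  have bdd: "bdd_below Q" "bdd_above Q"
    using Q(2) by (auto simp: bounded_imp_bdd_below bounded_imp_bdd_above)
  have sub: "Q \<subseteq> {Inf Q..Sup Q}"
    using bdd by (auto intro: cInf_lower cSup_upper)
  have "{Inf Q<..<Sup Q} \<subseteq> Q"
  proof
    fix x assume "x \<in> {Inf Q<..<Sup Q}"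
    then obtain y z where "y \<in> Q" "y < x" "z \<in> Q" "x < z"
      using ne bdd by (auto simp: cInf_less_iff less_cSup_iff)
    then show "x \<in> Q" using Q(1) by (meson less_imp_le mem_is_interval_1_I)
  qed
  moreover have "Inf Q < Sup Q"
  proof (rule ccontr)
    assume "\<not> Inf Q < Sup Q"
    then have "Q \<subseteq> {Inf Q}" using sub by auto
    then have "Q = {} \<or> Q = {Inf Q}" by blast
    moreover have "measure lebesgue {Inf Q} = 0" by (simp add: measure_def)
    ultimately have "measure lebesgue Q = 0" by (metis measure_empty)
    with Q(3) show False by simp
  qed
  ultimately show ?thesis using sub that by blast
qed

lemma bounded_interval_borel: "bounded_interval Q \<Longrightarrow> Q \<in> sets borel"
  by (simp add: bounded_interval_def real_interval_borel_measurable)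

lemma interval_null_difference:
  fixes a b :: real
  assumes "Q \<in> sets borel" "{a<..<b} \<subseteq> Q" "Q \<subseteq> {a..b}"
  shows "(Q - {a..<b}) \<union> ({a..<b} - Q) \<in> null_sets lborel"
proof (rule null_sets_subset)
  show "{a, b::real} \<in> null_sets lborel" by (intro finite_imp_null_set_lborel) auto
  have "x = a \<or> x = b" if "x \<in> (Q - {a..<b}) \<union> ({a..<b} - Q)" for x
    using that assms(2,3) by force
  then show "(Q - {a..<b}) \<union> ({a..<b} - Q) \<subseteq> {a, b}" by blast
qed (use assms(1) in auto)

lemma nn_integral_interval:
  fixes a b :: real
  assumes "Q \<in> sets borel" "{a<..<b} \<subseteq> Q" "Q \<subseteq> {a..b}"
  shows "(\<integral>\<^sup>+x\<in>Q. f x \<partial>lborel) = (\<integral>\<^sup>+x\<in>{a..<b}. f x \<partial>lborel)"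
  using assms interval_null_difference[OF assms] by (intro nn_integral_null_delta) auto

lemma measure_interval:
  assumes "Q \<in> sets borel" "{a<..<b} \<subseteq> Q" "Q \<subseteq> {a..b}" "a < b"
  shows "emeasure lborel Q = ennreal (b - a)" "measure lebesgue Q = b - a"
proof -
  show e: "emeasure lborel Q = ennreal (b - a)"
    using nn_integral_interval[OF assms(1-3), of "\<lambda>_. 1"] assms(1,4) by simp
  then show "measure lebesgue Q = b - a"
    using assms(1,4) by (simp add: measure_def)
qed

text \<open>Replacing the average by another constant at most doubles the mean deviation, because the
  distance between the average and the constant is itself at most the mean deviation from
  that constant.\<close>

lemma mean_oscillation_le:
  assumes int: "set_integrable lebesgue Q h" and Q: "Q \<in> sets lebesgue" "emeasure lebesgue Q < \<infinity>"
    and pos: "0 < measure lebesgue Q" and R: "(LINT x:Q|lebesgue. \<bar>h x - c\<bar>) \<le> R"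
  shows "mean_oscillation h Q \<le> 2 * R / measure lebesgue Q"
proof -
  define L where "L = measure lebesgue Q"
  define A where "A = average h Q"
  have L: "0 < L" using pos by (simp add: L_def)
  have const: "set_integrable lebesgue Q (\<lambda>_. y)" for y :: real
    using Q by (simp add: set_integrable_def)
  have const_int: "(LINT x:Q|lebesgue. y) = L * y" for y :: real
    using Q by (simp add: set_lebesgue_integral_def L_def)
  have diff: "set_integrable lebesgue Q (\<lambda>x. h x - y)" for y
    by (intro set_integral_diff int const)
  have "A * L - c * L = (LINT x:Q|lebesgue. h x - c)"
    using L by (subst set_integral_diff(2)[OF int const]) (simp add: const_int A_def average_def L_def)
  then have "\<bar>A - c\<bar> * L = \<bar>LINT x:Q|lebesgue. h x - c\<bar>"
    using L by (metis abs_mult abs_of_pos left_diff_distrib)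
  also have "\<dots> \<le> (LINT x:Q|lebesgue. \<bar>h x - c\<bar>)"
    using integral_abs_bound[of lebesgue "\<lambda>x. indicator Q x *\<^sub>R (h x - c)"]
    by (simp add: set_lebesgue_integral_def abs_mult)
  also note R
  finally have Ac: "\<bar>A - c\<bar> * L \<le> R" .
  have "(LINT x:Q|lebesgue. \<bar>h x - A\<bar>) \<le> (LINT x:Q|lebesgue. \<bar>h x - c\<bar> + \<bar>A - c\<bar>)"
    by (intro set_integral_mono set_integrable_abs set_integral_add diff const) auto
  also have "\<dots> = (LINT x:Q|lebesgue. \<bar>h x - c\<bar>) + L * \<bar>A - c\<bar>"
    by (subst set_integral_add(2)[OF set_integrable_abs[OF diff] const]) (simp add: const_int)
  also have "\<dots> \<le> 2 * R" using R Ac by (simp add: mult.commute)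
  finally show ?thesis
    using L unfolding mean_oscillation_def A_def[symmetric] L_def[symmetric] by (simp add: field_simps)
qed

text \<open>Whatever the average is, its distances to \<open>u\<close> and to \<open>v\<close> add up to at least \<open>\<bar>u - v\<bar>\<close>.\<close>

lemma mean_oscillation_ge:
  assumes int: "set_integrable lebesgue Q h" and Q: "Q \<in> sets lebesgue" "emeasure lebesgue Q < \<infinity>"
    and AB: "A \<in> sets lebesgue" "B \<in> sets lebesgue" "A \<subseteq> Q" "B \<subseteq> Q" "A \<inter> B = {}"
    and A: "\<And>x. x \<in> A \<Longrightarrow> h x = u" and B: "\<And>x. x \<in> B \<Longrightarrow> h x = v"
    and m: "m \<le> measure lebesgue A" "m \<le> measure lebesgue B" "0 \<le> m"
  shows "m * \<bar>u - v\<bar> / measure lebesgue Q \<le> mean_oscillation h Q"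
proof -
  define y where "y = average h Q"
  have const: "set_integrable lebesgue Q (\<lambda>_. y)" for y :: real
    using Q by (simp add: set_integrable_def)
  have absint: "set_integrable lebesgue Q (\<lambda>x. \<bar>h x - y\<bar>)"
    by (intro set_integrable_abs set_integral_diff int const)
  have fin: "emeasure lebesgue X < \<infinity>" if "X \<subseteq> Q" "X \<in> sets lebesgue" for X
    using emeasure_mono[OF that(1) Q(1)] Q(2) by (rule le_less_trans)
  have piece: "(LINT x:X|lebesgue. \<bar>h x - y\<bar>) = measure lebesgue X * \<bar>w - y\<bar>"
    if "X \<subseteq> Q" "X \<in> sets lebesgue" "\<And>x. x \<in> X \<Longrightarrow> h x = w" for X w
  proof -
    have "(LINT x:X|lebesgue. \<bar>h x - y\<bar>) = (LINT x:X|lebesgue. \<bar>w - y\<bar>)"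
      using that by (intro set_lebesgue_integral_cong) auto
    then show ?thesis using that fin[OF that(1,2)] by (simp add: set_lebesgue_integral_def)
  qed
  have "m * \<bar>u - v\<bar> \<le> m * (\<bar>u - y\<bar> + \<bar>v - y\<bar>)"
    using m(3) by (intro mult_left_mono) auto
  also have "\<dots> \<le> measure lebesgue A * \<bar>u - y\<bar> + measure lebesgue B * \<bar>v - y\<bar>"
    using m by (simp add: distrib_left add_mono mult_right_mono)
  also have "\<dots> = (LINT x:A|lebesgue. \<bar>h x - y\<bar>) + (LINT x:B|lebesgue. \<bar>h x - y\<bar>)"
    using AB A B by (simp add: piece)
  also have "\<dots> = (LINT x:A \<union> B|lebesgue. \<bar>h x - y\<bar>)"
    using AB by (intro set_integral_Un[symmetric] set_integrable_subset[OF absint]) auto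
  also have "\<dots> \<le> (LINT x:Q|lebesgue. \<bar>h x - y\<bar>)"
    unfolding set_lebesgue_integral_def
    using absint set_integrable_subset[OF absint, of "A \<union> B"] AB
    by (intro integral_mono) (auto simp: set_integrable_def indicator_def)
  finally show ?thesis
    unfolding mean_oscillation_def y_def[symmetric] by (simp add: divide_right_mono)
qed

section \<open>Comparing measures cell by cell\<close>

definition grid_cell :: "real \<Rightarrow> int \<Rightarrow> real set" where
  "grid_cell w i = {of_int i * w ..< (of_int i + 1) * w}"

lemma grid_cell_measurable [measurable]: "grid_cell w i \<in> sets borel"
  by (simp add: grid_cell_def)

lemma mem_grid_cell: "0 < w \<Longrightarrow> x \<in> grid_cell w i \<longleftrightarrow> \<lfloor>x / w\<rfloor> = i"
  by (auto simp: grid_cell_def floor_eq_iff field_simps)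

text \<open>Membership in intervals with endpoints on the grid \<open>w\<int>\<close> depends only on \<open>\<lfloor>x / w\<rfloor>\<close>, so questions about
  unions of cells become questions about integers.\<close>

lemma mem_grid_interval:
  "0 < w \<Longrightarrow> x \<in> {of_int a * w ..< of_int b * w} \<longleftrightarrow> a \<le> \<lfloor>x / w\<rfloor> \<and> \<lfloor>x / w\<rfloor> < b"
  by (simp add: le_floor_iff floor_less_iff field_simps)

lemma grid_interval_inter_cell:
  assumes "0 < w"
  shows "{of_int a * w ..< of_int b * w} \<inter> grid_cell w j = (if a \<le> j \<and> j < b then grid_cell w j else {})"
  using assms by (auto simp: mem_grid_interval mem_grid_cell simp del: atLeastLessThan_iff)

lemma emeasure_sum_grid_cells:
  fixes M :: "real measure"
  assumes "0 < w" "sets M = sets borel" "A \<in> sets borel"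
  shows "emeasure M A = (\<Sum>n. emeasure M (A \<inter> grid_cell w (int_decode n)))"
proof -
  have "(\<Sum>n. emeasure M (A \<inter> grid_cell w (int_decode n)))
      = emeasure M (\<Union>n. A \<inter> grid_cell w (int_decode n))"
  proof (rule suminf_emeasure)
    show "range (\<lambda>n. A \<inter> grid_cell w (int_decode n)) \<subseteq> sets M"
      unfolding assms(2) using assms(3) by (intro image_subsetI sets.Int grid_cell_measurable)
    have "m = n" if "x \<in> grid_cell w (int_decode m)" "x \<in> grid_cell w (int_decode n)" for x m n
    proof -
      have "int_decode m = int_decode n"
        using that unfolding mem_grid_cell[OF assms(1)] by (rule trans[OF sym])
      then show ?thesis by (metis int_decode_inverse)
    qed
    then show "disjoint_family (\<lambda>n. A \<inter> grid_cell w (int_decode n))"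
      unfolding disjoint_family_on_def by blast
  qed
  also have "(\<Union>n. A \<inter> grid_cell w (int_decode n)) = A"
  proof -
    have "x \<in> grid_cell w (int_decode (int_encode \<lfloor>x / w\<rfloor>))" for x
      by (simp add: mem_grid_cell[OF assms(1)])
    then have "(\<Union>n. grid_cell w (int_decode n)) = UNIV"
      by blast
    then show ?thesis unfolding Int_UN_distrib[symmetric] by (simp only: Int_UNIV_right)
  qed
  finally show ?thesis by simp
qed

text \<open>By countable additivity, a comparison of measures may be made on single cells, and a single cell
  of any level below meets the cores of its level in one interval.\<close>

lemma emeasure_le_cellwise:
  fixes M N :: "real measure"
  assumes "0 < w" "sets M = sets borel" "sets N = sets borel"
    and "A \<in> sets borel" "B \<in> sets borel"
    and "\<And>i. emeasure M (A \<inter> grid_cell w i) \<le> c * emeasure N (B \<inter> grid_cell w i)"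
  shows "emeasure M A \<le> c * emeasure N B"
  unfolding emeasure_sum_grid_cells[OF assms(1,2,4)] emeasure_sum_grid_cells[OF assms(1,3,5)]
    ennreal_suminf_cmult[symmetric]
  by (intro suminf_le assms(6)) auto

lemma emeasure_eq_cellwise:
  fixes M N :: "real measure"
  assumes "0 < w" "sets M = sets borel" "sets N = sets borel"
    and "A \<in> sets borel" "B \<in> sets borel"
    and "\<And>i. emeasure M (A \<inter> grid_cell w i) = c * emeasure N (B \<inter> grid_cell w i)"
  shows "emeasure M A = c * emeasure N B"
  unfolding emeasure_sum_grid_cells[OF assms(1,2,4)] emeasure_sum_grid_cells[OF assms(1,3,5)]
    ennreal_suminf_cmult[symmetric] assms(6) ..

section \<open>Nested cells and their cores\<close>

text \<open>The scale \<open>s\<close> is the length of the largest cells, \<open>2 * d\<close> is the number $D$ and \<open>H\<close> is $D^{1/p}$.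
  The condition \<open>2 * H \<le> d\<close> says that $2H/D \le 1/2$, so that the series of heights against
  measures near a grid point is dominated by a geometric series.\<close>

locale nested_cells =
  fixes s H p :: real and d :: nat
  assumes s_pos: "0 < s" and H_gt_1: "1 < H" and p_gt_1: "1 < p"
    and H_le: "2 * H \<le> real d" and H_powr: "H powr p = 2 * real d"
begin

abbreviation D :: real where "D \<equiv> 2 * real d"

lemma D_gt_4: "4 < D"
  using H_gt_1 H_le by simp

lemma d_pos [simp]: "0 < d"
  using D_gt_4 by (cases d) auto

lemma d_nonzero [simp]: "d \<noteq> 0"
  using d_pos by simp

text \<open>The factor \<open>2 ^ Suc k\<close> is the number of cells of level \<open>k + 1\<close> in a core of level \<open>k\<close>. It has to grow
  with a summable reciprocal: the end cells of the cores, which are charged separately,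
  make up the proportion \<open>2 / 2 ^ Suc k\<close> of the cores of level \<open>k\<close>.\<close>

primrec width :: "nat \<Rightarrow> real" where
  "width 0 = s"
| "width (Suc k) = width k / (D * 2 ^ Suc k)"

lemma width_pos [simp]: "0 < width k"
  by (induction k) (auto simp: s_pos)

lemma width_sign [simp]: "\<not> width k \<le> 0" "0 \<le> width k" "\<not> width k < 0" "width k \<noteq> 0"
  using width_pos[of k] by linarith+

lemma width_step: "width k = D * 2 ^ Suc k * width (Suc k)"
  using d_pos by (simp del: power_Suc)

declare width.simps(2) [simp del]

lemma width_Suc_le: "width (Suc k) \<le> width k / 2"
proof -
  have "2 * 1 \<le> D * 2 ^ Suc k"
    using D_gt_4 by (intro mult_mono) (auto simp del: power_Suc)
  then have "2 * 1 * width (Suc k) \<le> D * 2 ^ Suc k * width (Suc k)"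
    by (intro mult_right_mono) (auto intro: less_imp_le)
  then show ?thesis unfolding width_step[of k] by simp
qed

lemma width_le: "width k \<le> s / 2 ^ k"
proof (induction k)
  case (Suc k)
  have "width (Suc k) \<le> width k / 2" by (rule width_Suc_le)
  also have "\<dots> \<le> s / 2 ^ k / 2" using Suc by simp
  also have "\<dots> = s / 2 ^ Suc k" by simp
  finally show ?case .
qed simp

abbreviation cell :: "nat \<Rightarrow> int \<Rightarrow> real set" where
  "cell k \<equiv> grid_cell (width k)"

abbreviation lo :: "nat \<Rightarrow> int \<Rightarrow> real" where
  "lo k i \<equiv> (of_int i + 1/2) * width k"

abbreviation hi :: "nat \<Rightarrow> int \<Rightarrow> real" where
  "hi k i \<equiv> (of_int i + 1/2 + 1/D) * width k"

text \<open>The cores start at the midpoints of the cells. What matters is that they stay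
  away from both ends of the cell: if cores touched the ends, towers would pile up at a
  point and grow there like a power function.\<close>

definition core :: "nat \<Rightarrow> int \<Rightarrow> real set" where
  "core k i = {lo k i ..< hi k i}"

definition cores :: "nat \<Rightarrow> real set" where
  "cores k = (\<Union>i. core k i)"

lemma core_subset_cell: "core k i \<subseteq> cell k i"
proof -
  have "1/D \<le> 1/2" using D_gt_4 by (simp add: field_simps)
  then have "(of_int i + 1/2 + 1/D) * width k \<le> (of_int i + 1) * width k"
    "of_int i * width k \<le> (of_int i + 1/2) * width k"
    by (intro mult_right_mono less_imp_le[OF width_pos]; linarith)+
  then show ?thesis unfolding core_def grid_cell_def by auto
qed

lemma cores_inter_cell: "cores k \<inter> cell k i = core k i"
  using core_subset_cell by (fastforce simp: cores_def mem_grid_cell)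

lemma cores_measurable [measurable]: "cores k \<in> sets borel"
  by (auto simp: cores_def core_def)

lemma core_grid:
  "core k i = {of_int ((2 * int d * i + int d) * 2 ^ Suc k) * width (Suc k) ..<
               of_int (((2 * int d * i + int d) + 1) * 2 ^ Suc k) * width (Suc k)}"
proof -
  have "(of_int i + 1/2) * width k = of_int ((2 * int d * i + int d) * 2 ^ Suc k) * width (Suc k)"
    by (subst width_step) (simp add: algebra_simps)
  moreover have "(of_int i + 1/2 + 1/D) * width k = of_int (((2 * int d * i + int d) + 1) * 2 ^ Suc k) * width (Suc k)"
    by (subst width_step) (simp add: field_simps)
  ultimately show ?thesis by (simp add: core_def)
qed

lemma emeasure_cell: "emeasure lborel (cell k i) = ennreal (width k)"
  by (simp add: grid_cell_def algebra_simps less_imp_le)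

lemma emeasure_core: "emeasure lborel (core k i) = ennreal (1/D * width k)"
proof -
  have "0 \<le> 1/D * width k" by (simp add: less_imp_le)
  then show ?thesis by (simp add: core_def algebra_simps)
qed

text \<open>For \<open>k = 0\<close> these are the decreasing sets \<open>S n\<close> that carry the tower. A general starting level makes
  self-similarity available: inside \<open>S k\<close>, the set \<open>S (k + n)\<close> looks like \<open>chain k n\<close>, and \<open>chain k\<close> can be
  treated by induction on the number of levels.\<close>

definition chain :: "nat \<Rightarrow> nat \<Rightarrow> real set" where
  "chain k n = (\<Inter>j\<in>{k..<k+n}. cores j)"

abbreviation S :: "nat \<Rightarrow> real set" where "S \<equiv> chain 0"

lemma chain_0 [simp]: "chain k 0 = UNIV" by (simp add: chain_def)

lemma chain_Suc: "chain k (Suc n) = cores k \<inter> chain (Suc k) n"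
proof -
  have "{k..<k + Suc n} = insert k {Suc k..<Suc k + n}" by auto
  then show ?thesis by (simp add: chain_def)
qed

lemma chain_add: "chain k (m + n) = chain k m \<inter> chain (k + m) n"
proof -
  have "{k..<k + (m + n)} = {k..<k + m} \<union> {k + m..<k + m + n}" by auto
  then show ?thesis by (auto simp: chain_def)
qed

lemma S_Suc: "S (Suc k) = S k \<inter> cores k"
  using chain_add[of 0 k 1] by (simp add: chain_Suc)

lemma S_antimono: "j \<le> k \<Longrightarrow> S k \<subseteq> S j"
  by (auto simp: chain_def)

lemma chain_measurable [measurable]: "chain k n \<in> sets borel"
  by (induction n arbitrary: k) (auto simp: chain_Suc)

text \<open>The core of a cell is a union of whole cells of the next level, so every level multiplies the measure by
  exactly \<open>1/D\<close>.\<close>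

lemma emeasure_chain_cell:
  "emeasure lborel (chain k n \<inter> cell k i) = ennreal ((1/D) ^ n) * emeasure lborel (cell k i)"
proof (induction n arbitrary: k i)
  case (Suc n)
  have "chain k (Suc n) \<inter> cell k i = chain (Suc k) n \<inter> core k i"
    using cores_inter_cell by (auto simp: chain_Suc)
  moreover have "emeasure lborel (chain (Suc k) n \<inter> core k i)
      = ennreal ((1/D) ^ n) * emeasure lborel (core k i)"
  proof (rule emeasure_eq_cellwise[where w = "width (Suc k)"])
    fix j
    have "core k i \<inter> cell (Suc k) j = cell (Suc k) j \<or> core k i \<inter> cell (Suc k) j = {}"
      unfolding core_grid grid_interval_inter_cell[OF width_pos] by presburger
    then show "emeasure lborel (chain (Suc k) n \<inter> core k i \<inter> cell (Suc k) j)
      = ennreal ((1/D) ^ n) * emeasure lborel (core k i \<inter> cell (Suc k) j)"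
      using Suc.IH[of "Suc k" j] by (auto simp: Int_assoc)
  qed (auto simp: core_def)
  moreover have "emeasure lborel (core k i) = ennreal (1/D) * emeasure lborel (cell k i)"
    by (simp add: emeasure_core emeasure_cell less_imp_le flip: ennreal_mult)
  ultimately show ?case by (simp add: mult_ac flip: ennreal_mult)
qed simp

section \<open>The measure of iterated cores near a grid point\<close>

lemma lo_grid: "\<exists>A. lo k i = of_int A * width (Suc k)"
  by (rule exI[of _ "(2 * int d * i + int d) * 2 ^ Suc k"], subst width_step) (simp add: algebra_simps)

lemma hi_grid: "\<exists>A. hi k i = of_int A * width (Suc k)"
  by (rule exI[of _ "(2 * int d * i + int d + 1) * 2 ^ Suc k"], subst width_step) (simp add: field_simps)

lemma hi_lo: "hi k i = lo k i + 1/D * width k"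
  by (simp add: algebra_simps)

lemma core_length_bounds: "0 < 1/D * width k" "1/D * width k < width k / 4"
proof -
  show "0 < 1/D * width k" by simp
  have "1/D < 1/4" using D_gt_4 by (simp add: field_simps)
  from mult_strict_right_mono[OF this width_pos[of k]] show "1/D * width k < width k / 4" by simp
qed

lemma emeasure_chain_grid:
  "emeasure lborel (chain k n \<inter> {of_int a * width k ..< of_int b * width k})
    = ennreal ((1/D) ^ n) * emeasure lborel {of_int a * width k ..< of_int b * width k}"
  by (rule emeasure_eq_cellwise[where w = "width k"])
     (simp_all add: Int_assoc grid_interval_inter_cell emeasure_chain_cell)

text \<open>An interval that is not inside a core meets it in nothing, in a piece at one of its
  ends, or in the whole core; \<open>t = 0\<close> covers the first case.\<close>

lemma core_inter_cases:
  assumes "\<not> {a..<b} \<subseteq> core k i"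
  obtains t where "0 \<le> t" "t \<le> 1/D * width k" "core k i \<inter> {a..<b} = {lo k i ..< lo k i + t}"
  | t where "0 \<le> t" "t \<le> 1/D * width k" "core k i \<inter> {a..<b} = {hi k i - t ..< hi k i}"
proof -
  define l where "l = lo k i"
  define h where "h = hi k i"
  define w where "w = 1/D * width k"
  have h: "h = l + w" "0 < w" unfolding h_def l_def w_def by (rule hi_lo) simp
  have c: "core k i = {l..<h}" by (simp add: core_def l_def h_def)
  consider "a \<le> l" | "h \<le> b" | "l < a" "b < h" by linarith
  then show ?thesis
  proof cases
    case 1
    have "core k i \<inter> {a..<b} = {l ..< l + max 0 (min w (b - l))}"
      using 1 h unfolding c by (auto simp: max_def min_def)
    then show ?thesis using h by (intro that(1)[of "max 0 (min w (b - l))", folded l_def w_def]) auto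
  next
    case 2
    have "core k i \<inter> {a..<b} = {h - max 0 (min w (h - a)) ..< h}"
      using 2 h unfolding c by (auto simp: max_def min_def)
    then show ?thesis using h by (intro that(2)[of "max 0 (min w (h - a))", folded h_def w_def]) auto
  next
    case 3
    then have "{a..<b} \<subseteq> core k i" unfolding c by auto
    with assms show ?thesis by simp
  qed
qed

text \<open>Within one cell: starting from the left end, the half of the cell before the core has to be crossed
  before the core is reached, so the core has proportion at most \<open>(1/D) / (1/2)\<close> in the piece.\<close>

lemma emeasure_core_left_edge_le:
  assumes "a = of_int i * width k"
  shows "emeasure lborel (core k j \<inter> {a..<b}) \<le> ennreal (2/D) * emeasure lborel ({a..<b} \<inter> cell k j)"
proof (cases "i \<le> j")
  case False
  then have "of_int (j + 1) * width k \<le> a"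
    unfolding assms by (intro mult_right_mono less_imp_le[OF width_pos]) simp
  then have "{a..<b} \<inter> cell k j = {}" by (auto simp: grid_cell_def algebra_simps)
  then have "core k j \<inter> {a..<b} = {}" using core_subset_cell[of k j] by auto
  then show ?thesis by simp
next
  case True
  define z where "z = of_int j * width k"
  define e where "e = 1/D * width k"
  have az: "a \<le> z"
    unfolding assms z_def using True by (intro mult_right_mono less_imp_le[OF width_pos]) simp
  have e: "0 < e" "e < width k / 4" unfolding e_def by (rule core_length_bounds)+
  have core: "core k j = {z + width k / 2 ..< z + width k / 2 + e}"
    by (simp add: core_def z_def e_def algebra_simps)
  have cell: "cell k j = {z ..< z + width k}"
    by (simp add: grid_cell_def z_def algebra_simps)
  show ?thesis
  proof (cases "b \<le> z + width k / 2")
    case True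
    then have "core k j \<inter> {a..<b} = {}" unfolding core by auto
    then show ?thesis by simp
  next
    case False
    define t where "t = min b (z + width k) - z"
    have t: "width k / 2 \<le> t" using False width_pos[of k] unfolding t_def by (auto simp: min_def)
    have "{a..<b} \<inter> cell k j = {z ..< z + t}"
      unfolding cell t_def using az by auto
    moreover have "0 \<le> t" using t width_pos[of k] by linarith
    ultimately have "ennreal (2/D) * emeasure lborel ({a..<b} \<inter> cell k j) = ennreal (2/D * t)"
      by (simp flip: ennreal_mult)
    moreover have "emeasure lborel (core k j \<inter> {a..<b}) \<le> ennreal e"
      using emeasure_mono[of "core k j \<inter> {a..<b}" "core k j" lborel] e(1)
      by (simp add: core)
    moreover have "2/D * (width k / 2) \<le> 2/D * t"
      using t by (intro mult_left_mono) auto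
    then have "e \<le> 2/D * t" by (simp add: e_def)
    ultimately show ?thesis by (metis ennreal_leI order.trans)
  qed
qed

text \<open>Coming from the right, the gap has only length \<open>1/2 - 1/D\<close> of the cell, but the proportion of core in the piece is still
  largest when the piece contains exactly the whole core, and then it is \<open>(1/D) / (1/2)\<close>.\<close>

lemma emeasure_core_right_edge_le:
  assumes "b = of_int i * width k"
  shows "emeasure lborel (core k j \<inter> {a..<b}) \<le> ennreal (2/D) * emeasure lborel ({a..<b} \<inter> cell k j)"
proof (cases "j < i")
  case False
  then have "b \<le> of_int j * width k"
    unfolding assms by (intro mult_right_mono less_imp_le[OF width_pos]) simp
  then have "{a..<b} \<inter> cell k j = {}" by (auto simp: grid_cell_def algebra_simps)
  then have "core k j \<inter> {a..<b} = {}" using core_subset_cell[of k j] by auto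
  then show ?thesis by simp
next
  case True
  define z where "z = of_int j * width k"
  define e where "e = 1/D * width k"
  have "(of_int j + 1) * width k \<le> b"
    unfolding assms using True by (intro mult_right_mono less_imp_le[OF width_pos]) linarith
  then have bz: "z + width k \<le> b" by (simp add: z_def algebra_simps)
  have e: "0 < e" "e < width k / 4" unfolding e_def by (rule core_length_bounds)+
  have core: "core k j = {z + width k / 2 ..< z + width k / 2 + e}"
    by (simp add: core_def z_def e_def algebra_simps)
  have cell: "cell k j = {z ..< z + width k}"
    by (simp add: grid_cell_def z_def algebra_simps)
  show ?thesis
  proof (cases "z + width k / 2 + e \<le> a")
    case True
    then have "core k j \<inter> {a..<b} = {}" unfolding core by auto
    then show ?thesis by simp
  next
    case False
    define t where "t = z + width k - max a z"
    have t: "width k / 2 - e \<le> t" "0 \<le> t" using False width_pos[of k] e unfolding t_def by auto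
    have "{a..<b} \<inter> cell k j = {z + width k - t ..< z + width k}"
      unfolding cell t_def using bz by auto
    with t have rhs: "ennreal (2/D) * emeasure lborel ({a..<b} \<inter> cell k j) = ennreal (2/D * t)"
      by (simp flip: ennreal_mult)
    define u where "u = min e (e - width k / 2 + t)"
    have "z + width k / 2 + e - u \<le> max a (z + width k / 2)"
      unfolding u_def t_def using e by (simp add: min_def max_def)
    then have "core k j \<inter> {a..<b} \<subseteq> {z + width k / 2 + e - u ..< z + width k / 2 + e}"
      unfolding core by auto
    then have "emeasure lborel (core k j \<inter> {a..<b}) \<le> emeasure lborel {z + width k / 2 + e - u ..< z + width k / 2 + e}"
      by (intro emeasure_mono) auto
    also have "\<dots> = ennreal u" using t e by (simp add: u_def)
    also have "u \<le> 2/D * t"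
    proof (cases "t \<le> width k / 2")
      case True
      define q where "q = 1/D"
      have "0 \<le> 1 - 2 * q" using D_gt_4 by (simp add: q_def)
      with True have "(1 - 2 * q) * t \<le> (1 - 2 * q) * (width k / 2)"
        by (intro mult_left_mono) auto
      then have "q * width k - width k / 2 + t \<le> 2 * q * t" by (simp add: algebra_simps)
      then have "e - width k / 2 + t \<le> 2/D * t" by (simp add: e_def q_def)
      then show ?thesis by (simp add: u_def)
    next
      case False
      then have "2/D * (width k / 2) \<le> 2/D * t" by (intro mult_left_mono) auto
      then show ?thesis by (simp add: u_def e_def)
    qed
    then have "ennreal u \<le> ennreal (2/D * t)" by (rule ennreal_leI)
    finally show ?thesis unfolding rhs .
  qed
qed

lemma emeasure_cores_edge_le:
  assumes "a = of_int i * width k \<or> b = of_int i * width k"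
  shows "emeasure lborel (cores k \<inter> {a..<b}) \<le> ennreal (2/D) * emeasure lborel {a..<b}"
proof (rule emeasure_le_cellwise[where w = "width k"])
  fix j
  have "cores k \<inter> {a..<b} \<inter> cell k j = core k j \<inter> {a..<b}"
    using cores_inter_cell[of k j] by auto
  then show "emeasure lborel (cores k \<inter> {a..<b} \<inter> cell k j) \<le> ennreal (2/D) * emeasure lborel ({a..<b} \<inter> cell k j)"
    using assms emeasure_core_left_edge_le[of a i k j b] emeasure_core_right_edge_le[of b i k j a] by auto
qed auto

text \<open>Grid points are not in the closure of the cores of their level.\<close>

lemma edge_not_subset_cores:
  assumes "a < b" "a = of_int i * width k \<or> b = of_int i * width k"
  shows "\<not> {a..<b} \<subseteq> cores k"
proof
  assume sub: "{a..<b} \<subseteq> cores k"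
  have out: "x \<notin> cores k" if "x \<in> cell k j" "x \<notin> core k j" for x j
    using that cores_inter_cell[of k j] by auto
  have e: "0 < 1/D * width k" "1/D * width k < width k / 4" by (rule core_length_bounds)+
  from assms(2) show False
  proof
    assume "a = of_int i * width k"
    then have "a \<in> cell k i" "a \<notin> core k i"
      using width_pos[of k] by (simp_all add: grid_cell_def core_def algebra_simps)
    with out sub assms(1) show False by force
  next
    assume b: "b = of_int i * width k"
    define x where "x = max a (b - width k / 4)"
    have x: "b - width k / 4 \<le> x" "x < b" using assms(1) by (auto simp: x_def)
    have "x \<in> cell k (i - 1)"
      using x width_pos[of k] unfolding grid_cell_def by (simp add: b algebra_simps)
    moreover have "hi k (i - 1) = b - width k / 2 + 1/D * width k"
      by (simp add: b algebra_simps)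
    then have "x \<notin> core k (i - 1)"
      using x e unfolding core_def by simp
    moreover have "x \<in> {a..<b}" using assms(1) by (simp add: x_def)
    ultimately show False using out sub by blast
  qed
qed

text \<open>Cutting into cells of level \<open>k\<close> leaves pieces of cores with an end on the grid of level \<open>k + 1\<close>. For each
  of them \<open>emeasure_cores_edge_le\<close> gains a factor \<open>2/D\<close>, and by \<open>edge_not_subset_cores\<close> the
  piece satisfies the hypothesis again one level further.\<close>

lemma emeasure_chain_inter_cores_le:
  assumes "\<not> {a..<b} \<subseteq> cores k"
  shows "emeasure lborel (chain (Suc k) n \<inter> (cores k \<inter> {a..<b})) \<le> ennreal ((2/D) ^ n) * emeasure lborel (cores k \<inter> {a..<b})"
  using assms
proof (induction n arbitrary: k a b)
  case (Suc n)
  show ?case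
  proof (rule emeasure_le_cellwise[where w = "width k"])
    fix j
    have cell: "cores k \<inter> {a..<b} \<inter> cell k j = core k j \<inter> {a..<b}"
      using cores_inter_cell[of k j] by auto
    have "\<not> {a..<b} \<subseteq> core k j" using Suc.prems by (auto simp: cores_def)
    then obtain a' b' where ab: "core k j \<inter> {a..<b} = {a'..<b'}" "a' = lo k j \<or> b' = hi k j"
      by (cases rule: core_inter_cases) metis+
    then obtain A where A: "a' = of_int A * width (Suc k) \<or> b' = of_int A * width (Suc k)"
      using lo_grid hi_grid by metis
    have "emeasure lborel (chain (Suc k) (Suc n) \<inter> {a'..<b'}) \<le> ennreal ((2/D) ^ Suc n) * emeasure lborel {a'..<b'}"
    proof (cases "a' < b'")
      case True
      have "chain (Suc k) (Suc n) \<inter> {a'..<b'} = chain (Suc (Suc k)) n \<inter> (cores (Suc k) \<inter> {a'..<b'})"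
        by (auto simp: chain_Suc)
      then have "emeasure lborel (chain (Suc k) (Suc n) \<inter> {a'..<b'}) \<le> ennreal ((2/D) ^ n) * emeasure lborel (cores (Suc k) \<inter> {a'..<b'})"
        using Suc.IH[OF edge_not_subset_cores[OF True A]] by simp
      also have "\<dots> \<le> ennreal ((2/D) ^ n) * (ennreal (2/D) * emeasure lborel {a'..<b'})"
        by (intro mult_left_mono emeasure_cores_edge_le[OF A]) simp
      also have "\<dots> = ennreal ((2/D) ^ Suc n) * emeasure lborel {a'..<b'}"
        by (simp add: mult.assoc[symmetric] mult.commute flip: ennreal_mult)
      finally show ?thesis .
    qed simp
    then show "emeasure lborel (chain (Suc k) (Suc n) \<inter> (cores k \<inter> {a..<b}) \<inter> cell k j)
      \<le> ennreal ((2/D) ^ Suc n) * emeasure lborel (cores k \<inter> {a..<b} \<inter> cell k j)"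
      by (simp only: Int_assoc cell[unfolded Int_assoc] ab(1))
  qed auto
qed simp

section \<open>A measure that dominates the oscillation sums\<close>

lemma width_refine: "k \<le> l \<Longrightarrow> \<exists>q. width k = of_int q * width l"
proof (induction rule: inc_induct)
  case base
  show ?case by (rule exI[of _ 1]) simp
next
  case (step n)
  then obtain q where "width (Suc n) = of_int q * width l" by blast
  then have "width n = of_int (2 * int d * 2 ^ Suc n * q) * width l"
    by (subst width_step) (simp add: algebra_simps)
  then show ?case by blast
qed

lemma cell_dichotomy_grid:
  assumes "k \<le> l"
  shows "cell l j \<subseteq> {of_int a * width k ..< of_int b * width k} \<or> {of_int a * width k ..< of_int b * width k} \<inter> cell l j = {}"
proof -
  obtain q where q: "width k = of_int q * width l" using width_refine[OF assms] by blast
  have "{of_int a * width k ..< of_int b * width k} \<inter> cell l j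
    = {of_int (a * q) * width l ..< of_int (b * q) * width l} \<inter> cell l j"
    by (simp add: q mult.assoc)
  also have "\<dots> = cell l j \<or> \<dots> = {}"
    unfolding grid_interval_inter_cell[OF width_pos] by presburger
  finally show ?thesis by blast
qed

lemma cell_dichotomy_cores:
  assumes "k < l"
  shows "cell l j \<subseteq> cores k \<or> cores k \<inter> cell l j = {}"
proof -
  have "cell l j \<subseteq> core k i \<or> core k i \<inter> cell l j = {}" for i
    unfolding core_grid using assms by (intro cell_dichotomy_grid) simp
  then show ?thesis unfolding cores_def by blast
qed

lemma cell_dichotomy_S: "cell l j \<subseteq> S l \<or> S l \<inter> cell l j = {}"
proof -
  have "cell l j \<subseteq> cores k \<or> cores k \<inter> cell l j = {}" if "k < l" for k
    using that by (rule cell_dichotomy_cores)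
  then show ?thesis unfolding chain_def by fastforce
qed

text \<open>Later sets \<open>S N\<close> avoid the ends of the cores of level \<open>k\<close>. The end cells of these cores, cells of the next level,
  are where additional mass is placed.\<close>

definition edge :: "nat \<Rightarrow> real set" where
  "edge k = (\<Union>i. {lo k i ..< lo k i + width (Suc k)} \<union> {hi k i - width (Suc k) ..< hi k i})"

lemma edge_measurable [measurable]: "edge k \<in> sets borel"
  by (auto simp: edge_def)

lemma width_Suc_le_core: "width (Suc k) \<le> 1/D * width k"
proof -
  have "1 * width (Suc k) \<le> 2 ^ Suc k * width (Suc k)"
    by (intro mult_right_mono) (auto simp del: power_Suc)
  moreover have "1/D * width k = 2 ^ Suc k * width (Suc k)"
    by (subst width_step) simp
  ultimately show ?thesis by simp
qed

text \<open>The two end cells have total length \<open>2 * width (Suc k)\<close>, which is \<open>2 / 2 ^ Suc k\<close> times the length of the core.\<close>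

lemma emeasure_edge_cell: "emeasure lborel (edge k \<inter> cell k j) \<le> ennreal ((1/2) ^ k / D) * emeasure lborel (cell k j)"
proof -
  have sub: "{lo k i ..< lo k i + width (Suc k)} \<union> {hi k i - width (Suc k) ..< hi k i} \<subseteq> core k i" for i
    using width_Suc_le_core[of k] unfolding core_def hi_lo by auto
  have "edge k \<inter> cell k j \<subseteq> {lo k j ..< lo k j + width (Suc k)} \<union> {hi k j - width (Suc k) ..< hi k j}"
  proof
    fix x assume x: "x \<in> edge k \<inter> cell k j"
    then obtain i where i: "x \<in> {lo k i ..< lo k i + width (Suc k)} \<union> {hi k i - width (Suc k) ..< hi k i}"
      unfolding edge_def by blast
    with sub core_subset_cell have "x \<in> cell k i" by blast
    with x have "i = j" by (simp add: mem_grid_cell)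
    with i show "x \<in> {lo k j ..< lo k j + width (Suc k)} \<union> {hi k j - width (Suc k) ..< hi k j}" by simp
  qed
  then have "emeasure lborel (edge k \<inter> cell k j)
    \<le> emeasure lborel ({lo k j ..< lo k j + width (Suc k)} \<union> {hi k j - width (Suc k) ..< hi k j})"
    by (intro emeasure_mono) auto
  also have "\<dots> \<le> emeasure lborel {lo k j ..< lo k j + width (Suc k)} + emeasure lborel {hi k j - width (Suc k) ..< hi k j}"
    by (intro emeasure_subadditive) auto
  also have "\<dots> = ennreal (2 * width (Suc k))"
    by (simp flip: ennreal_plus)
  also have "2 * width (Suc k) = (1/2) ^ k / D * width k"
    by (subst (2) width_step) (simp add: power_divide)
  also have "ennreal \<dots> = ennreal ((1/2) ^ k / D) * emeasure lborel (cell k j)"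
    by (simp add: emeasure_cell flip: ennreal_mult)
  finally show ?thesis .
qed

lemma emeasure_S_edge_cell_le:
  "emeasure lborel (S (Suc k) \<inter> edge k \<inter> cell 0 i) \<le> ennreal ((1/2) ^ k * (1/D) ^ Suc k) * emeasure lborel (cell 0 i)"
proof -
  have "emeasure lborel (S (Suc k) \<inter> edge k \<inter> cell 0 i) \<le> emeasure lborel (S k \<inter> cell 0 i \<inter> edge k)"
    using S_antimono[of k "Suc k"] by (intro emeasure_mono) auto
  also have "\<dots> \<le> ennreal ((1/2) ^ k / D) * emeasure lborel (S k \<inter> cell 0 i)"
  proof (rule emeasure_le_cellwise[where w = "width k"])
    fix j
    have "cell k j \<subseteq> cell 0 i \<or> cell 0 i \<inter> cell k j = {}"
      using cell_dichotomy_grid[of 0 k j i "i + 1"] by (simp add: grid_cell_def)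
    then consider "S k \<inter> cell 0 i \<inter> cell k j = {}" | "S k \<inter> cell 0 i \<inter> cell k j = cell k j"
      using cell_dichotomy_S[of k j] by blast
    then show "emeasure lborel (S k \<inter> cell 0 i \<inter> edge k \<inter> cell k j)
      \<le> ennreal ((1/2) ^ k / D) * emeasure lborel (S k \<inter> cell 0 i \<inter> cell k j)"
    proof cases
      case 1
      then have "S k \<inter> cell 0 i \<inter> edge k \<inter> cell k j = {}" by blast
      then show ?thesis by simp
    next
      case 2
      then have "S k \<inter> cell 0 i \<inter> edge k \<inter> cell k j = edge k \<inter> cell k j" by blast
      with 2 show ?thesis using emeasure_edge_cell by simp
    qed
  qed auto
  also have "\<dots> = ennreal ((1/2) ^ k * (1/D) ^ Suc k) * emeasure lborel (cell 0 i)"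
    unfolding emeasure_chain_cell by (simp add: mult.assoc[symmetric] flip: ennreal_mult)
  finally show ?thesis .
qed

text \<open>The first term alone is the natural mass distribution on \<open>S N\<close>, which assigns to every cell of
  level \<open>k \<le> N\<close> inside \<open>S k\<close> the mass \<open>D ^ k\<close> times its length. It vanishes near the ends of the
  cores of levels below \<open>N - 1\<close>, and the second term makes up for this.\<close>

definition weight :: "nat \<Rightarrow> real \<Rightarrow> ennreal" where
  "weight N x = ennreal (D ^ N) * indicator (S N) x
     + (\<Sum>k<N. ennreal (D ^ Suc k) * indicator (S (Suc k) \<inter> edge k) x)"

definition charge :: "nat \<Rightarrow> real measure" where
  "charge N = density lborel (weight N)"

lemma weight_measurable [measurable]: "weight N \<in> borel_measurable borel"
  unfolding weight_def by measurable

lemma sets_charge [simp]: "sets (charge N) = sets borel"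
  by (simp add: charge_def)

lemma emeasure_charge:
  assumes [measurable]: "A \<in> sets borel"
  shows "emeasure (charge N) A = ennreal (D ^ N) * emeasure lborel (S N \<inter> A)
     + (\<Sum>k<N. ennreal (D ^ Suc k) * emeasure lborel (S (Suc k) \<inter> edge k \<inter> A))"
proof -
  have "emeasure (charge N) A = (\<integral>\<^sup>+x. weight N x * indicator A x \<partial>lborel)"
    unfolding charge_def by (rule emeasure_density) auto
  also have "\<dots> = (\<integral>\<^sup>+x. ennreal (D ^ N) * indicator (S N \<inter> A) x
     + (\<Sum>k<N. ennreal (D ^ Suc k) * indicator (S (Suc k) \<inter> edge k \<inter> A) x) \<partial>lborel)"
    by (intro nn_integral_cong) (simp add: weight_def indicator_inter_arith distrib_right sum_distrib_right mult.assoc)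
  also have "\<dots> = (\<integral>\<^sup>+x. ennreal (D ^ N) * indicator (S N \<inter> A) x \<partial>lborel)
     + (\<integral>\<^sup>+x. (\<Sum>k<N. ennreal (D ^ Suc k) * indicator (S (Suc k) \<inter> edge k \<inter> A) x) \<partial>lborel)"
    by (rule nn_integral_add) measurable
  also have "(\<integral>\<^sup>+x. (\<Sum>k<N. ennreal (D ^ Suc k) * indicator (S (Suc k) \<inter> edge k \<inter> A) x) \<partial>lborel)
     = (\<Sum>k<N. \<integral>\<^sup>+x. ennreal (D ^ Suc k) * indicator (S (Suc k) \<inter> edge k \<inter> A) x \<partial>lborel)"
    by (rule nn_integral_sum) measurable
  also have "(\<integral>\<^sup>+x. ennreal (D ^ N) * indicator (S N \<inter> A) x \<partial>lborel) = ennreal (D ^ N) * emeasure lborel (S N \<inter> A)"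
    by (rule nn_integral_cmult_indicator) simp
  also have "(\<Sum>k<N. \<integral>\<^sup>+x. ennreal (D ^ Suc k) * indicator (S (Suc k) \<inter> edge k \<inter> A) x \<partial>lborel)
     = (\<Sum>k<N. ennreal (D ^ Suc k) * emeasure lborel (S (Suc k) \<inter> edge k \<inter> A))"
    by (intro sum.cong refl nn_integral_cmult_indicator) simp
  finally show ?thesis .
qed

text \<open>The natural mass distribution contributes \<open>1\<close> per unit length and the end cells of the cores of level \<open>k\<close> at
  most \<open>2 ^ (-k)\<close>.\<close>

lemma emeasure_charge_cell_le: "emeasure (charge N) (cell 0 i) \<le> 3 * emeasure lborel (cell 0 i)"
proof -
  have "emeasure (charge N) (cell 0 i) \<le> ennreal (D ^ N) * (ennreal ((1/D) ^ N) * emeasure lborel (cell 0 i))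
     + (\<Sum>k<N. ennreal (D ^ Suc k) * (ennreal ((1/2) ^ k * (1/D) ^ Suc k) * emeasure lborel (cell 0 i)))"
    unfolding emeasure_charge[OF grid_cell_measurable] emeasure_chain_cell
    by (intro add_mono sum_mono mult_left_mono emeasure_S_edge_cell_le order.refl) auto
  also have "\<dots> = (1 + (\<Sum>k<N. ennreal ((1/2) ^ k))) * emeasure lborel (cell 0 i)"
  proof -
    have cancel: "ennreal (D ^ n) * (ennreal (x * (1/D) ^ n) * y) = ennreal x * y" if "0 \<le> x" for n x y
    proof -
      have "D ^ n * (x * (1/D) ^ n) = x" by (simp add: power_divide)
      moreover have "ennreal (D ^ n) * (ennreal (x * (1/D) ^ n) * y) = ennreal (D ^ n * (x * (1/D) ^ n)) * y"
        using that by (subst ennreal_mult) (auto simp: mult.assoc)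
      ultimately show ?thesis by (simp only:)
    qed
    have "ennreal (D ^ N) * (ennreal ((1/D) ^ N) * y) = y" for y
      using cancel[of 1 N y] by simp
    moreover have "ennreal (D ^ Suc k) * (ennreal ((1/2) ^ k * (1/D) ^ Suc k) * y) = ennreal ((1/2) ^ k) * y" for k y
      by (rule cancel) simp
    ultimately show ?thesis by (simp only: distrib_right sum_distrib_right mult_1_left)
  qed
  also have "(1 + (\<Sum>k<N. ennreal ((1/2) ^ k))) = ennreal (1 + (\<Sum>k<N. (1/2) ^ k))"
    by (simp add: sum_nonneg flip: ennreal_1 del: ennreal_1)
  also have "\<dots> \<le> ennreal 3"
  proof (rule ennreal_leI)
    have "(\<Sum>k<N. (1/2::real) ^ k) = 2 - 2 * (1/2) ^ N"
      by (induction N) auto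
    then show "1 + (\<Sum>k<N. (1/2::real) ^ k) \<le> 3" by simp
  qed
  finally show ?thesis by (simp add: mult_right_mono)
qed

lemma emeasure_charge_grid_le:
  "emeasure (charge N) {of_int a * s ..< of_int b * s} \<le> 3 * emeasure lborel {of_int a * s ..< of_int b * s}"
proof (rule emeasure_le_cellwise[where w = "width 0"])
  fix i
  show "emeasure (charge N) ({of_int a * s ..< of_int b * s} \<inter> cell 0 i)
    \<le> 3 * emeasure lborel ({of_int a * s ..< of_int b * s} \<inter> cell 0 i)"
    using emeasure_charge_cell_le[of N i] grid_interval_inter_cell[OF s_pos, of a b i] by simp
qed (auto simp: s_pos)

lemma charge_ge_grid:
  assumes "k \<le> N" "{of_int a * width k ..< of_int b * width k} \<subseteq> S k"
  shows "ennreal (D ^ k) * emeasure lborel {of_int a * width k ..< of_int b * width k}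
    \<le> emeasure (charge N) {of_int a * width k ..< of_int b * width k}" (is "_ * emeasure lborel ?J \<le> _")
proof -
  obtain n where N: "N = k + n" using assms(1) le_Suc_ex by blast
  have "S N \<inter> ?J = chain k n \<inter> ?J"
    using assms(2) chain_add[of 0 k n] unfolding N by auto
  then have "ennreal (D ^ N) * emeasure lborel (S N \<inter> ?J) = ennreal (D ^ N) * (ennreal ((1/D) ^ n) * emeasure lborel ?J)"
    by (simp only: emeasure_chain_grid)
  also have "\<dots> = ennreal (D ^ N * (1/D) ^ n) * emeasure lborel ?J"
    by (simp add: mult.assoc[symmetric] flip: ennreal_mult)
  also have "D ^ N * (1/D) ^ n = D ^ k" by (simp add: N power_add power_divide)
  finally show ?thesis
    by (subst emeasure_charge) (auto intro: order_trans[OF _ add_increasing2])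
qed

lemma charge_ge_edge:
  assumes "k < N" "A \<subseteq> S (Suc k) \<inter> edge k" "A \<in> sets borel"
  shows "ennreal (D ^ Suc k) * emeasure lborel A \<le> emeasure (charge N) A"
proof -
  have "S (Suc k) \<inter> edge k \<inter> A = A" using assms(2) by auto
  then have "ennreal (D ^ Suc k) * emeasure lborel A = ennreal (D ^ Suc k) * emeasure lborel (S (Suc k) \<inter> edge k \<inter> A)"
    by simp
  also have "\<dots> \<le> (\<Sum>k<N. ennreal (D ^ Suc k) * emeasure lborel (S (Suc k) \<inter> edge k \<inter> A))"
    using assms(1) by (intro member_le_sum) auto
  finally show ?thesis
    by (subst emeasure_charge[OF assms(3)]) (rule add_increasing[OF zero_le])
qed

text \<open>A short piece lies in an end cell of the core. A longer piece of length \<open>t\<close> contains \<open>\<lfloor>t / width (Suc k)\<rfloor> \<ge> 1\<close>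
  consecutive full cells, counted from the end of the core, and these fill at least half of it.\<close>

lemma charge_ge_anchored:
  assumes "k < N" "0 \<le> t" "t \<le> 1/D * width k"
    and A: "A = {lo k i ..< lo k i + t} \<or> A = {hi k i - t ..< hi k i}" and sub: "A \<subseteq> S (Suc k)"
  shows "ennreal (D ^ Suc k) * emeasure lborel A \<le> 2 * emeasure (charge N) A"
proof (cases "t \<le> width (Suc k)")
  case True
  have "A \<subseteq> edge k"
    using A
  proof
    assume "A = {lo k i ..< lo k i + t}"
    then have "A \<subseteq> {lo k i ..< lo k i + width (Suc k)}" using True by auto
    then show ?thesis unfolding edge_def by blast
  next
    assume "A = {hi k i - t ..< hi k i}"
    then have "A \<subseteq> {hi k i - width (Suc k) ..< hi k i}" using True by auto
    then show ?thesis unfolding edge_def by blast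
  qed
  then have "ennreal (D ^ Suc k) * emeasure lborel A \<le> 1 * emeasure (charge N) A"
    using charge_ge_edge[OF assms(1), of A] sub A by auto
  also have "\<dots> \<le> 2 * emeasure (charge N) A" by (intro mult_right_mono) auto
  finally show ?thesis .
next
  case False
  define j where "j = \<lfloor>t / width (Suc k)\<rfloor>"
  have j: "of_int j * width (Suc k) \<le> t" "t < (of_int j + 1) * width (Suc k)"
    using floor_divide_lower[of "width (Suc k)" t] floor_divide_upper[of "width (Suc k)" t] by (auto simp: j_def)
  have "1 \<le> j" using False by (simp add: j_def le_floor_iff)
  then have "(of_int j + 1) * width (Suc k) \<le> (2 * of_int j) * width (Suc k)"
    by (intro mult_right_mono) auto
  then have t: "t \<le> 2 * (of_int j * width (Suc k))" using j by linarith
  obtain a b where ab: "of_int b * width (Suc k) - of_int a * width (Suc k) = of_int j * width (Suc k)"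
    "{of_int a * width (Suc k) ..< of_int b * width (Suc k)} \<subseteq> A"
    using A
  proof
    assume A: "A = {lo k i ..< lo k i + t}"
    obtain a where a: "lo k i = of_int a * width (Suc k)" using lo_grid by blast
    show ?thesis using j by (intro that[of "a + j" a]; (unfold A a)?; auto simp: algebra_simps)
  next
    assume A: "A = {hi k i - t ..< hi k i}"
    obtain a where a: "hi k i = of_int a * width (Suc k)" using hi_grid by blast
    show ?thesis using j by (intro that[of a "a - j"]; (unfold A a)?; auto simp: algebra_simps)
  qed
  let ?J = "{of_int a * width (Suc k) ..< of_int b * width (Suc k)}"
  have jpos: "0 \<le> of_int j * width (Suc k)" using \<open>1 \<le> j\<close> by simp
  have "emeasure lborel A = ennreal t" using A assms(2) by auto
  also have "\<dots> \<le> ennreal (2 * (of_int j * width (Suc k)))" using t by (rule ennreal_leI)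
  also have "\<dots> = 2 * ennreal (of_int j * width (Suc k))"
    using jpos by (simp add: ennreal_mult)
  also have "ennreal (of_int j * width (Suc k)) = emeasure lborel ?J"
  proof -
    have "of_int a * width (Suc k) \<le> of_int b * width (Suc k)" using ab(1) jpos by linarith
    then show ?thesis by (simp only: emeasure_lborel_Ico ab(1))
  qed
  finally have "ennreal (D ^ Suc k) * emeasure lborel A \<le> ennreal (D ^ Suc k) * (2 * emeasure lborel ?J)"
    by (intro mult_left_mono) auto
  also have "\<dots> = 2 * (ennreal (D ^ Suc k) * emeasure lborel ?J)" by (simp only: mult_ac)
  also have "\<dots> \<le> 2 * emeasure (charge N) ?J"
    using assms(1) ab(2) sub by (intro mult_left_mono charge_ge_grid) auto
  also have "\<dots> \<le> 2 * emeasure (charge N) A"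
    using ab(2) A by (intro mult_left_mono emeasure_mono) auto
  finally show ?thesis .
qed

lemma charge_ge:
  assumes "k < N" "{a..<b} \<subseteq> S k" "\<not> {a..<b} \<subseteq> cores k"
  shows "emeasure lborel (cores k \<inter> {a..<b}) \<le> ennreal (2 / D ^ Suc k) * emeasure (charge N) {a..<b}"
proof (rule emeasure_le_cellwise[where w = "width k"])
  fix j
  let ?A = "core k j \<inter> {a..<b}"
  have cell: "cores k \<inter> {a..<b} \<inter> cell k j = ?A"
    using cores_inter_cell[of k j] by auto
  have "\<not> {a..<b} \<subseteq> core k j" using assms(3) by (auto simp: cores_def)
  then obtain t where "0 \<le> t" "t \<le> 1/D * width k" "?A = {lo k j ..< lo k j + t} \<or> ?A = {hi k j - t ..< hi k j}"
    by (cases rule: core_inter_cases) metis+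
  moreover have "?A \<subseteq> S (Suc k)"
    using assms(2) by (auto simp: S_Suc cores_def)
  ultimately have *: "ennreal (D ^ Suc k) * emeasure lborel ?A \<le> 2 * emeasure (charge N) ?A"
    using charge_ge_anchored[OF assms(1)] by blast
  have "emeasure lborel ?A = ennreal (1 / D ^ Suc k) * (ennreal (D ^ Suc k) * emeasure lborel ?A)"
    by (simp add: mult.assoc[symmetric] flip: ennreal_mult)
  also have "\<dots> \<le> ennreal (1 / D ^ Suc k) * (2 * emeasure (charge N) ?A)"
    by (intro mult_left_mono *) simp
  also have "\<dots> = ennreal (2 / D ^ Suc k) * emeasure (charge N) ?A"
    by (simp add: mult.assoc[symmetric] flip: ennreal_mult ennreal_numeral)
  also have "\<dots> \<le> ennreal (2 / D ^ Suc k) * emeasure (charge N) ({a..<b} \<inter> cell k j)"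
    using core_subset_cell[of k j] by (intro mult_left_mono emeasure_mono) auto
  finally show "emeasure lborel (cores k \<inter> {a..<b} \<inter> cell k j)
    \<le> ennreal (2 / D ^ Suc k) * emeasure (charge N) ({a..<b} \<inter> cell k j)"
    unfolding cell .
qed auto

section \<open>The tower function\<close>

definition tail :: "nat \<Rightarrow> real \<Rightarrow> ennreal" where
  "tail k x = (\<Sum>n. ennreal (H ^ (k + n)) * indicator (S (Suc (k + n))) x)"

text \<open>The series diverges on the null set \<open>\<Inter>k. S k\<close>, where \<open>enn2real\<close> gives the value \<open>0\<close>.\<close>

definition tower :: "real \<Rightarrow> real" where
  "tower x = enn2real (tail 0 x)"

text \<open>The value of the tower on \<open>S k - S (Suc k)\<close>.\<close>

definition level :: "nat \<Rightarrow> real" where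
  "level k = (\<Sum>j<k. H ^ j)"

lemma H_pos: "0 < H" using H_gt_1 by simp

lemma level_nonneg: "0 \<le> level k"
  using H_pos by (auto simp: level_def intro!: sum_nonneg)

lemma tail_measurable [measurable]: "tail k \<in> borel_measurable borel"
  unfolding tail_def by measurable

lemma tower_measurable [measurable]: "tower \<in> borel_measurable borel"
  unfolding tower_def by measurable

lemma tail_split:
  assumes "x \<in> S k"
  shows "tail 0 x = ennreal (level k) + tail k x"
proof -
  have "indicator (S (Suc j)) x = (1::ennreal)" if "j < k" for j
    using assms S_antimono[of "Suc j" k] that by auto
  then have "(\<Sum>j<k. ennreal (H ^ j) * indicator (S (Suc j)) x) = ennreal (level k)"
    using H_pos by (simp add: level_def flip: sum_ennreal)
  then show ?thesis
    unfolding tail_def using suminf_offset[of "\<lambda>n. ennreal (H ^ n) * indicator (S (Suc n)) x" k]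
    by (simp add: add.commute)
qed

text \<open>Where the tail is infinite there is nothing to prove; so the estimate holds at every point of \<open>S k\<close>,
  including those where the series diverges.\<close>

lemma tower_deviation_le_tail:
  assumes "x \<in> S k"
  shows "ennreal \<bar>tower x - level k\<bar> \<le> tail k x"
proof (cases "tail k x")
  case (real r)
  then have "tail 0 x = ennreal (level k + r)"
    using tail_split[OF assms] level_nonneg by simp
  then have "tower x = enn2real (ennreal (level k + r))"
    by (simp only: tower_def)
  also have "\<dots> = level k + r"
    using real level_nonneg[of k] by (intro enn2real_ennreal) simp
  finally have "tower x = level k + r" .
  with real show ?thesis by simp
next
  case top
  then show ?thesis by simp
qed

lemma tower_eq_level:
  assumes "x \<in> S k" "x \<notin> cores k"
  shows "tower x = level k"
proof -
  have "x \<notin> S (Suc (k + n))" for n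
    using assms(2) S_antimono[of "Suc k" "Suc (k + n)"] S_Suc[of k] by auto
  then have "tail k x = 0" by (simp add: tail_def)
  with tower_deviation_le_tail[OF assms(1)] show ?thesis by simp
qed

text \<open>The height \<open>H ^ (k + n)\<close> meets a set of proportion at most \<open>(2/D) ^ n\<close> in \<open>cores k \<inter> {a..<b}\<close>, and
  \<open>H * (2/D) \<le> 1/2\<close>.\<close>

lemma nn_integral_tail_le:
  assumes "{a..<b} \<subseteq> S k" "\<not> {a..<b} \<subseteq> cores k"
  shows "(\<integral>\<^sup>+x\<in>{a..<b}. tail k x \<partial>lborel) \<le> ennreal (2 * H ^ k) * emeasure lborel (cores k \<inter> {a..<b})"
proof -
  let ?m = "emeasure lborel (cores k \<inter> {a..<b})"
  have "(\<integral>\<^sup>+x\<in>{a..<b}. tail k x \<partial>lborel)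
    = (\<integral>\<^sup>+x. (\<Sum>n. ennreal (H ^ (k + n)) * indicator (chain (Suc k) n \<inter> (cores k \<inter> {a..<b})) x) \<partial>lborel)"
  proof (rule nn_integral_cong)
    fix x
    have "S (Suc (k + n)) \<inter> {a..<b} = chain (Suc k) n \<inter> (cores k \<inter> {a..<b})" for n
      using assms(1) chain_add[of 0 k "Suc n"] by (auto simp: chain_Suc)
    then have "indicator (S (Suc (k + n))) x * indicator {a..<b} x = (indicator (chain (Suc k) n \<inter> (cores k \<inter> {a..<b})) x :: ennreal)" for n
      by (metis indicator_inter_arith)
    then show "tail k x * indicator {a..<b} x = (\<Sum>n. ennreal (H ^ (k + n)) * indicator (chain (Suc k) n \<inter> (cores k \<inter> {a..<b})) x)"
      by (simp add: tail_def mult.assoc flip: ennreal_suminf_multc)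
  qed
  also have "\<dots> = (\<Sum>n. \<integral>\<^sup>+x. ennreal (H ^ (k + n)) * indicator (chain (Suc k) n \<inter> (cores k \<inter> {a..<b})) x \<partial>lborel)"
    by (rule nn_integral_suminf) measurable
  also have "\<dots> = (\<Sum>n. ennreal (H ^ (k + n)) * emeasure lborel (chain (Suc k) n \<inter> (cores k \<inter> {a..<b})))"
    by (intro suminf_cong nn_integral_cmult_indicator) simp
  also have "\<dots> \<le> (\<Sum>n. ennreal (H ^ k * (1/2) ^ n) * ?m)"
  proof (intro suminf_le summableI)
    fix n
    have "ennreal (H ^ (k + n)) * emeasure lborel (chain (Suc k) n \<inter> (cores k \<inter> {a..<b})) \<le> ennreal (H ^ (k + n)) * (ennreal ((2/D) ^ n) * ?m)"
      by (intro mult_left_mono emeasure_chain_inter_cores_le assms(2)) auto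
    also have "\<dots> = ennreal (H ^ (k + n) * (2/D) ^ n) * ?m"
      using H_pos by (simp add: mult.assoc[symmetric] flip: ennreal_mult)
    also have "\<dots> \<le> ennreal (H ^ k * (1/2) ^ n) * ?m"
    proof (intro mult_right_mono ennreal_leI)
      have "H * (2/D) \<le> 1/2" using H_le by (simp add: field_simps)
      then have "(H * (2/D)) ^ n \<le> (1/2) ^ n" using H_pos by (intro power_mono) auto
      then have "H ^ k * (H * (2/D)) ^ n \<le> H ^ k * (1/2) ^ n" using H_pos by (intro mult_left_mono) auto
      then show "H ^ (k + n) * (2/D) ^ n \<le> H ^ k * (1/2) ^ n" by (simp only: power_add power_mult_distrib mult.assoc)
    qed auto
    finally show "ennreal (H ^ (k + n)) * emeasure lborel (chain (Suc k) n \<inter> (cores k \<inter> {a..<b})) \<le> ennreal (H ^ k * (1/2) ^ n) * ?m" .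
  qed
  also have "\<dots> = (\<Sum>n. ennreal (H ^ k * (1/2) ^ n)) * ?m" by simp
  also have "(\<Sum>n. ennreal (H ^ k * (1/2) ^ n)) = ennreal (H ^ k * 2)"
    using H_pos geometric_sums[of "1/2::real"] by (intro suminf_ennreal_eq sums_mult) auto
  finally show ?thesis by (simp add: mult.commute)
qed

lemma nn_integral_tower_deviation_le:
  assumes "{a..<b} \<subseteq> S k" "\<not> {a..<b} \<subseteq> cores k"
  shows "(\<integral>\<^sup>+x\<in>{a..<b}. ennreal \<bar>tower x - level k\<bar> \<partial>lborel) \<le> ennreal (2 * H ^ k) * emeasure lborel (cores k \<inter> {a..<b})"
proof (rule order_trans[OF nn_integral_mono nn_integral_tail_le[OF assms]])
  fix x
  show "ennreal \<bar>tower x - level k\<bar> * indicator {a..<b} x \<le> tail k x * indicator {a..<b} x"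
    using tower_deviation_le_tail[of x k] assms(1) by (auto simp: indicator_def)
qed

lemma bounded_subset_grid:
  fixes Q :: "real set"
  assumes "bounded Q"
  obtains m where "0 < m" "Q \<subseteq> {of_int (- m) * s ..< of_int m * s}"
proof -
  obtain r where r: "\<And>x. x \<in> Q \<Longrightarrow> \<bar>x\<bar> \<le> r" using assms by (auto simp: bounded_iff)
  define m where "m = \<lfloor>\<bar>r\<bar> / s\<rfloor> + 1"
  have m: "\<bar>r\<bar> < of_int m * s"
    using floor_divide_upper[OF s_pos, of "\<bar>r\<bar>"] by (simp add: m_def)
  have "0 \<le> \<bar>r\<bar> / s" using s_pos by simp
  then have "0 < m" unfolding m_def by linarith
  moreover have "Q \<subseteq> {of_int (- m) * s ..< of_int m * s}" using r m by (force simp: abs_le_iff)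
  ultimately show ?thesis by (rule that)
qed

text \<open>An interval with endpoints on the coarsest grid is an instance of the estimate above with \<open>k = 0\<close>, since \<open>S 0\<close> is
  the whole line and \<open>level 0 = 0\<close>.\<close>

lemma tower_integrable:
  assumes "Q \<in> sets borel" "bounded Q"
  shows "set_integrable lebesgue Q tower"
proof -
  obtain m where m: "0 < m" "Q \<subseteq> {of_int (- m) * s ..< of_int m * s}"
    using assms(2) by (rule bounded_subset_grid)
  let ?J = "{of_int (- m) * s ..< of_int m * s}"
  have lt: "of_int (- m) * s < of_int m * s" using m(1) s_pos by simp
  then have "\<not> ?J \<subseteq> cores 0" using edge_not_subset_cores[of "of_int (- m) * s" "of_int m * s" m 0] by simp
  then have "(\<integral>\<^sup>+x\<in>?J. ennreal \<bar>tower x - level 0\<bar> \<partial>lborel) \<le> ennreal (2 * H ^ 0) * emeasure lborel (cores 0 \<inter> ?J)"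
    by (intro nn_integral_tower_deviation_le) auto
  also have "\<dots> \<le> ennreal (2 * H ^ 0) * emeasure lborel ?J"
    by (intro mult_left_mono emeasure_mono) auto
  also have "\<dots> < \<infinity>"
    unfolding emeasure_lborel_Ico[OF less_imp_le[OF lt]] by (simp add: ennreal_mult_less_top)
  finally have "(\<integral>\<^sup>+x\<in>?J. ennreal \<bar>tower x\<bar> \<partial>lborel) < \<infinity>" by (simp add: level_def)
  moreover have "(\<integral>\<^sup>+x. ennreal (norm (indicator Q x *\<^sub>R tower x)) \<partial>lborel) \<le> (\<integral>\<^sup>+x\<in>?J. ennreal \<bar>tower x\<bar> \<partial>lborel)"
    using m(2) by (intro nn_integral_mono) (auto simp: indicator_def)
  ultimately have "integrable lborel (\<lambda>x. indicator Q x *\<^sub>R tower x)"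
    using assms(1) by (intro integrableI_bounded) (auto intro: le_less_trans)
  then show ?thesis
    using assms(1) by (simp add: set_integrable_def integrable_completion)
qed

lemma ex_width_less:
  assumes "0 < r"
  shows "\<exists>k. width k < r"
proof -
  obtain k where "s / r < 2 ^ k" using real_arch_pow[of 2 "s / r"] by auto
  then have "s / 2 ^ k < r" using assms by (simp add: field_simps)
  then show ?thesis using width_le[of k] by (auto intro: le_less_trans)
qed

text \<open>An interval longer than a cell of level \<open>k\<close> contains a grid point of level \<open>k\<close> and so is not inside \<open>S (Suc k)\<close>; take
  the first level where this inclusion fails.\<close>

lemma smallest_level:
  assumes "a < b"
  obtains k where "{a..<b} \<subseteq> S k" "\<not> {a..<b} \<subseteq> cores k"
proof -
  obtain k where w: "width k < b - a" using assms ex_width_less[of "b - a"] by auto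
  define i where "i = \<lceil>a / width k\<rceil>"
  have i: "a \<le> of_int i * width k" "of_int i * width k < a + width k"
    using ceiling_divide_upper[OF width_pos[of k], of a] ceiling_divide_lower[OF width_pos[of k], of a]
    by (auto simp: i_def algebra_simps)
  then have "\<not> {of_int i * width k ..< b} \<subseteq> cores k"
    using w by (intro edge_not_subset_cores) auto
  moreover have "{of_int i * width k ..< b} \<subseteq> {a..<b}" using i by simp
  ultimately have "\<not> {a..<b} \<subseteq> cores k" by blast
  then have ex: "\<not> {a..<b} \<subseteq> S (Suc k)" using S_Suc by auto
  define m where "m = (LEAST m. \<not> {a..<b} \<subseteq> S (Suc m))"
  have 1: "\<not> {a..<b} \<subseteq> S (Suc m)"
    unfolding m_def using ex by (rule LeastI)
  have 2: "{a..<b} \<subseteq> S m"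
  proof (cases m)
    case (Suc m')
    then show ?thesis using not_less_Least[of m' "\<lambda>m. \<not> {a..<b} \<subseteq> S (Suc m)"] by (simp add: m_def)
  qed simp
  from 1 2 have "\<not> {a..<b} \<subseteq> cores m" by (auto simp: S_Suc)
  with 2 show ?thesis by (rule that)
qed

lemma H_powr_power: "(H ^ k) powr p = D ^ k"
proof -
  have "(H ^ k) powr p = (H powr p) powr real k"
    using H_pos by (simp add: powr_powr mult.commute flip: powr_realpow)
  also have "\<dots> = D ^ k" using H_powr by (simp add: powr_realpow)
  finally show ?thesis .
qed

text \<open>With \<open>k\<close> the last level such that the interval lies in \<open>S k\<close>, the mean oscillation is at
  most \<open>4 * H ^ k\<close> times the proportion \<open>\<theta>\<close> of \<open>cores k\<close> in the interval, and \<open>\<theta> powr p \<le> \<theta>\<close>. The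
  bound holds for all large \<open>N\<close>, so finitely many intervals can share one \<open>N\<close>.\<close>

lemma oscillation_le_charge:
  assumes "bounded_interval Q"
  obtains k where "\<And>N. k < N \<Longrightarrow>
    ennreal (measure lebesgue Q * mean_oscillation tower Q powr p) \<le> ennreal (4 powr p) * emeasure (charge N) Q"
proof -
  have Qb: "Q \<in> sets borel" using assms by (rule bounded_interval_borel)
  obtain a b where ab: "a < b" and Q: "{a<..<b} \<subseteq> Q" "Q \<subseteq> {a..b}"
    using assms by (rule bounded_interval_ends)
  note lenQ = measure_interval[OF Qb Q ab]
  obtain k where k: "{a..<b} \<subseteq> S k" "\<not> {a..<b} \<subseteq> cores k" using ab by (rule smallest_level)
  define m where "m = measure lborel (cores k \<inter> {a..<b})"
  have le: "emeasure lborel (cores k \<inter> {a..<b}) \<le> ennreal (b - a)"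
    using emeasure_mono[of "cores k \<inter> {a..<b}" "{a..<b}" lborel] ab by simp
  then have "emeasure lborel (cores k \<inter> {a..<b}) < top"
    by (rule le_less_trans) simp
  then have em: "emeasure lborel (cores k \<inter> {a..<b}) = ennreal m"
    by (simp add: m_def emeasure_eq_ennreal_measure)
  have mle: "m \<le> b - a"
    using le ab by (simp add: em)
  have m0: "0 \<le> m" by (simp add: m_def)
  have int: "set_integrable lebesgue Q tower"
    using Qb assms by (intro tower_integrable) (auto simp: bounded_interval_def)
  have "(\<integral>\<^sup>+x\<in>Q. ennreal \<bar>tower x - level k\<bar> \<partial>lborel) \<le> ennreal (2 * H ^ k) * ennreal m"
    unfolding nn_integral_interval[OF Qb Q] em[symmetric] by (rule nn_integral_tower_deviation_le[OF k])
  then have nn: "(\<integral>\<^sup>+x\<in>Q. ennreal \<bar>tower x - level k\<bar> \<partial>lborel) \<le> ennreal (2 * H ^ k * m)"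
    using H_pos m0 by (simp flip: ennreal_mult)
  have "(LINT x:Q|lebesgue. \<bar>tower x - level k\<bar>) = (LINT x:Q|lborel. \<bar>tower x - level k\<bar>)"
    unfolding set_lebesgue_integral_def using Qb by (intro integral_completion) auto
  also have "\<dots> = enn2real (\<integral>\<^sup>+x. ennreal (indicator Q x *\<^sub>R \<bar>tower x - level k\<bar>) \<partial>lborel)"
    unfolding set_lebesgue_integral_def using Qb by (intro integral_eq_nn_integral) auto
  also have "(\<integral>\<^sup>+x. ennreal (indicator Q x *\<^sub>R \<bar>tower x - level k\<bar>) \<partial>lborel) = (\<integral>\<^sup>+x\<in>Q. ennreal \<bar>tower x - level k\<bar> \<partial>lborel)"
    by (intro nn_integral_cong) (auto simp: indicator_def)
  also have "enn2real \<dots> \<le> 2 * H ^ k * m"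
    using nn H_pos m0 by (intro enn2real_leI) auto
  finally have "mean_oscillation tower Q \<le> 2 * (2 * H ^ k * m) / measure lebesgue Q"
    using Qb lenQ ab by (intro mean_oscillation_le[OF int]) auto
  then have osc: "mean_oscillation tower Q \<le> 4 * H ^ k * (m / (b - a))"
    by (simp add: lenQ)
  have osc0: "0 \<le> mean_oscillation tower Q"
    unfolding mean_oscillation_def set_lebesgue_integral_def by simp
  have "mean_oscillation tower Q powr p \<le> (4 * H ^ k * (m / (b - a))) powr p"
    using osc osc0 p_gt_1 by (intro powr_mono2) auto
  also have "\<dots> = 4 powr p * D ^ k * (m / (b - a)) powr p"
  proof -
    have "(4 * H ^ k * y) powr p = 4 powr p * (H ^ k) powr p * y powr p" if "0 \<le> y" for y
      using that H_pos by (simp add: powr_mult)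
    from this[of "m / (b - a)"] show ?thesis using m0 ab by (simp only: H_powr_power) simp
  qed
  also have "\<dots> \<le> 4 powr p * D ^ k * (m / (b - a))"
  proof (intro mult_left_mono)
    show "(m / (b - a)) powr p \<le> m / (b - a)"
    proof (cases "m = 0")
      case False
      with m0 have "(m / (b - a)) powr p \<le> (m / (b - a)) powr 1"
        using mle ab p_gt_1 by (intro powr_mono') auto
      then show ?thesis using m0 ab by simp
    qed simp
  qed simp
  finally have "(b - a) * mean_oscillation tower Q powr p \<le> (b - a) * (4 powr p * D ^ k * (m / (b - a)))"
    using ab by (intro mult_left_mono) auto
  also have "\<dots> = 4 powr p * D ^ k * m" using ab by simp
  finally have bound: "measure lebesgue Q * mean_oscillation tower Q powr p \<le> 4 powr p * D ^ k * m"
    by (simp add: lenQ)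
  show ?thesis
  proof (rule that)
    fix N assume N: "k < N"
    have chargeQ: "emeasure (charge N) Q = emeasure (charge N) {a..<b}"
      using Qb nn_integral_interval[OF Qb Q] by (simp add: charge_def emeasure_density)
    have "ennreal (measure lebesgue Q * mean_oscillation tower Q powr p) \<le> ennreal (4 powr p * D ^ k) * ennreal m"
      using bound m0 by (simp flip: ennreal_mult)
    also have "\<dots> \<le> ennreal (4 powr p * D ^ k) * (ennreal (2 / D ^ Suc k) * emeasure (charge N) {a..<b})"
      unfolding em[symmetric] by (intro mult_left_mono charge_ge[OF N k]) simp
    also have "\<dots> = ennreal (4 powr p * (2 / D)) * emeasure (charge N) {a..<b}"
      by (simp add: mult.assoc[symmetric] flip: ennreal_mult)
    also have "\<dots> \<le> ennreal (4 powr p) * emeasure (charge N) {a..<b}"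
      using D_gt_4 by (intro mult_right_mono ennreal_leI mult_right_le_one_le) auto
    finally show "ennreal (measure lebesgue Q * mean_oscillation tower Q powr p) \<le> ennreal (4 powr p) * emeasure (charge N) Q"
      unfolding chargeQ .
  qed
qed

section \<open>Membership in the two spaces\<close>

text \<open>A finite disjoint subfamily admits a common \<open>N\<close>, and then its oscillation sum is bounded by the
  charge of an interval around \<open>Q0\<close>, which does not depend on the subfamily.\<close>

lemma tower_in_JN:
  assumes "bounded_interval Q0"
  shows "tower \<in> JN p Q0"
proof -
  have Q0: "Q0 \<in> sets borel" "bounded Q0"
    using assms by (auto simp: bounded_interval_borel) (simp add: bounded_interval_def)
  obtain m where m: "0 < m" "Q0 \<subseteq> {of_int (- m) * s ..< of_int m * s}"
    using Q0(2) by (rule bounded_subset_grid)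
  let ?J = "{of_int (- m) * s ..< of_int m * s}"
  define B where "B = 4 powr p * (3 * (2 * (of_int m * s)))"
  have ms: "0 < of_int m * s" using m(1) s_pos by simp
  have B: "0 < B" using ms by (simp add: B_def)
  have chargeJ: "emeasure (charge N) ?J \<le> ennreal (3 * (2 * (of_int m * s)))" for N
  proof -
    have "of_int m * s - of_int (- m) * s = 2 * (of_int m * s)" by simp
    moreover have "emeasure lborel ?J = ennreal (of_int m * s - of_int (- m) * s)"
      using ms by (intro emeasure_lborel_Ico) simp
    ultimately have "3 * emeasure lborel ?J = ennreal (3 * (2 * (of_int m * s)))"
      using ms by (simp only: ennreal_mult ennreal_numeral)
    then show ?thesis
      using emeasure_charge_grid_le[of N "- m" m] by simp
  qed
  have "JN_sum p tower F \<le> ennreal B" if F: "F \<in> interval_collections Q0" for F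
    unfolding JN_sum_def
  proof (rule infsum_le_finite_sums)
    fix G assume G: "finite G" "G \<subseteq> F"
    have bi: "bounded_interval Q" "Q \<subseteq> Q0" if "Q \<in> G" for Q
      using that G F by (auto simp: interval_collections_def)
    have disj: "disjoint G"
      using F G(2) by (auto simp: interval_collections_def intro: pairwise_subset)
    have "\<forall>Q\<in>G. \<exists>k. \<forall>N>k. ennreal (measure lebesgue Q * mean_oscillation tower Q powr p) \<le> ennreal (4 powr p) * emeasure (charge N) Q"
    proof
      fix Q assume "Q \<in> G"
      then show "\<exists>k. \<forall>N>k. ennreal (measure lebesgue Q * mean_oscillation tower Q powr p) \<le> ennreal (4 powr p) * emeasure (charge N) Q"
        by (rule oscillation_le_charge[OF bi(1)]) blast
    qed
    then obtain \<kappa> where \<kappa>: "\<And>Q N. Q \<in> G \<Longrightarrow> \<kappa> Q < N \<Longrightarrow>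
        ennreal (measure lebesgue Q * mean_oscillation tower Q powr p) \<le> ennreal (4 powr p) * emeasure (charge N) Q"
      by (auto simp: bchoice_iff)
    obtain N where N: "\<And>Q. Q \<in> G \<Longrightarrow> \<kappa> Q < N"
      using finite_nat_set_iff_bounded[of "\<kappa> ` G"] G(1) by auto
    have "(\<Sum>Q\<in>G. ennreal (measure lebesgue Q * mean_oscillation tower Q powr p))
        \<le> (\<Sum>Q\<in>G. ennreal (4 powr p) * emeasure (charge N) Q)"
      using \<kappa> N by (intro sum_mono) blast
    also have "\<dots> = ennreal (4 powr p) * (\<Sum>Q\<in>G. emeasure (charge N) Q)"
      by (simp add: sum_distrib_left)
    also have "(\<Sum>Q\<in>G. emeasure (charge N) Q) = emeasure (charge N) (\<Union>Q\<in>G. Q)"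
      using G(1) bi(1) disj by (intro sum_emeasure) (auto simp: bounded_interval_borel disjoint_family_on_def disjoint_def)
    also have "\<dots> \<le> emeasure (charge N) ?J"
      using bi(2) m(2) by (intro emeasure_mono) auto
    also have "\<dots> \<le> ennreal (3 * (2 * (of_int m * s)))" by (rule chargeJ)
    finally show "(\<Sum>Q\<in>G. ennreal (measure lebesgue Q * mean_oscillation tower Q powr p)) \<le> ennreal B"
      using ms by (simp add: B_def ennreal_mult mult_left_mono)
  qed (simp add: nonneg_summable_on_complete)
  moreover have "(B powr (1 / p)) powr p = B"
    using B p_gt_1 by (simp add: powr_powr)
  ultimately have "\<forall>F\<in>interval_collections Q0. JN_sum p tower F \<le> ennreal ((B powr (1 / p)) powr p)"
    by simp
  then show ?thesis
    unfolding JN_def using tower_integrable[OF Q0] by (auto intro!: exI[of _ "B powr (1 / p)"])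
qed

text \<open>The proportion, in a cell of level \<open>k\<close>, of its core without the cores of level \<open>k + 1\<close>: the set
  where the tower is exactly one step above its value off the core.\<close>

definition jump :: real where
  "jump = (1/D) * (1 - 1/D)"

lemma jump_pos: "0 < jump"
  using D_gt_4 by (simp add: jump_def)

lemma jump_le_half: "jump \<le> 1/2"
proof -
  have "1/D \<le> 1/4" "1 - 1/D \<le> 1" "0 \<le> 1 - 1/D" using D_gt_4 by (auto simp: field_simps)
  then have "jump \<le> 1/4 * 1" unfolding jump_def by (intro mult_mono) auto
  then show ?thesis by simp
qed

lemma measure_cell: "measure lebesgue (cell k j) = width k"
  by (simp add: emeasure_cell measure_def)

lemma cell_oscillation_ge:
  assumes "cell k j \<subseteq> S k"
  shows "jump * H ^ k \<le> mean_oscillation tower (cell k j)"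
proof -
  let ?Q = "cell k j"
  define A where "A = {of_int j * width k ..< lo k j}"
  define B where "B = core k j - cores (Suc k)"
  have lo: "lo k j = of_int j * width k + width k / 2" by (simp add: algebra_simps)
  have A_sub: "A \<subseteq> ?Q" unfolding A_def lo grid_cell_def by (auto simp: algebra_simps)
  have A_core: "A \<inter> core k j = {}" by (auto simp: A_def core_def)
  have B_sub: "B \<subseteq> core k j" by (simp add: B_def)
  have core: "core k j \<subseteq> ?Q" "core k j \<subseteq> cores k"
    using core_subset_cell by (auto simp: cores_def)
  have [measurable]: "A \<in> sets borel" "B \<in> sets borel" by (auto simp: A_def B_def core_def)
  have "tower x = level k" if "x \<in> A" for x
    using that A_sub A_core assms cores_inter_cell[of k j] by (intro tower_eq_level) auto
  moreover have "tower x = level (Suc k)" if "x \<in> B" for x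
    using that B_sub core assms by (intro tower_eq_level) (auto simp: S_Suc B_def)
  moreover have "jump * width k \<le> measure lebesgue A"
    using mult_right_mono[OF jump_le_half, of "width k"] by (simp add: A_def lo)
  moreover have "jump * width k \<le> measure lebesgue B"
  proof -
    have core_fin: "emeasure lborel (core k j) = ennreal (1/D * width k)" by (rule emeasure_core)
    have "emeasure lborel (chain (Suc k) 1 \<inter> core k j) = ennreal ((1/D) ^ 1) * emeasure lborel (core k j)"
      unfolding core_grid by (rule emeasure_chain_grid)
    then have "emeasure lborel (cores (Suc k) \<inter> core k j) = ennreal (1/D) * emeasure lborel (core k j)"
      by (simp add: chain_Suc)
    then have "emeasure lborel (core k j \<inter> cores (Suc k)) = ennreal (1/D * (1/D * width k))"
      by (simp add: core_fin Int_commute flip: ennreal_mult)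
    moreover have "measure lborel (core k j - core k j \<inter> cores (Suc k)) = measure lborel (core k j) - measure lborel (core k j \<inter> cores (Suc k))"
      using core_fin by (intro measure_Diff) (auto simp: core_def)
    moreover have "core k j - core k j \<inter> cores (Suc k) = B" by (auto simp: B_def)
    ultimately have "measure lborel B = 1/D * width k - 1/D * (1/D * width k)"
      using core_fin by (simp add: measure_def)
    then show ?thesis by (simp add: jump_def algebra_simps)
  qed
  ultimately have "jump * width k * \<bar>level k - level (Suc k)\<bar> / measure lebesgue ?Q \<le> mean_oscillation tower ?Q"
    using jump_pos A_sub A_core B_sub core
    by (intro mean_oscillation_ge[of ?Q tower A B] tower_integrable)
       (auto simp: emeasure_cell grid_cell_def)
  then show ?thesis using H_pos by (simp add: measure_cell level_def)
qed

text \<open>The cells of level \<open>k\<close> in \<open>S k \<inter> cell 0 i\<close> exhaust this set, whose measure is \<open>s / D ^ k\<close>, while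
  each of them contributes at least \<open>jump powr p * D ^ k\<close> times its length.\<close>

lemma JN_sum_cells_ge:
  fixes k i
  defines "F \<equiv> cell k ` {j. cell k j \<subseteq> S k \<inter> cell 0 i}"
  assumes "cell 0 i \<subseteq> Q0"
  shows "F \<in> interval_collections Q0" "\<forall>Q\<in>F. measure lebesgue Q = width k"
    "ennreal (jump powr p * s) \<le> JN_sum p tower F"
proof -
  define I where "I = {j. cell k j \<subseteq> S k \<inter> cell 0 i}"
  have F: "F = cell k ` I" by (simp add: F_def I_def)
  have disj: "cell k j \<inter> cell k j' = {}" if "j \<noteq> j'" for j j'
    using that by (auto simp: mem_grid_cell)
  have cell_mem: "of_int j * width k \<in> cell k j" for j
    by (simp add: grid_cell_def algebra_simps)
  have inj: "inj_on (cell k) I"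
    by (rule inj_onI) (metis cell_mem disj disjoint_iff)
  obtain q where q: "width 0 = of_int q * width k" using width_refine[of 0 k] by blast
  have "of_int n * width 0 = of_int (n * q) * width k" for n
    unfolding q by simp
  then have cell0: "cell 0 i = {of_int (i * q) * width k ..< of_int ((i + 1) * q) * width k}"
    unfolding grid_cell_def by (metis of_int_1 of_int_add)
  have "I \<subseteq> {i * q ..< (i + 1) * q}"
  proof
    fix j assume "j \<in> I"
    then have "cell k j \<subseteq> {of_int (i * q) * width k ..< of_int ((i + 1) * q) * width k}"
      unfolding I_def cell0 by blast
    with cell_mem[of j] grid_interval_inter_cell[OF width_pos, of "i * q" k "(i + 1) * q" j]
    show "j \<in> {i * q ..< (i + 1) * q}" by (auto split: if_splits)
  qed
  then have fin: "finite I" by (rule finite_subset) simp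
  have bi: "bounded_interval (cell k j)" for j
    by (simp add: bounded_interval_def measure_cell) (simp add: grid_cell_def is_interval_co)
  have "cell k j \<inter> cell k j' = {}" if "cell k j \<noteq> cell k j'" for j j'
    using that disj by metis
  then have "disjoint F" unfolding F disjoint_def by blast
  moreover have "Q \<subseteq> Q0" if "Q \<in> F" for Q
    using that assms(2) unfolding F I_def by blast
  ultimately show "F \<in> interval_collections Q0"
    using fin bi unfolding interval_collections_def F
    by (simp add: countable_finite)
  show "\<forall>Q\<in>F. measure lebesgue Q = width k"
    by (auto simp: F measure_cell)
  have "(\<Union>j\<in>I. cell k j) = S k \<inter> cell 0 i"
  proof
    show "S k \<inter> cell 0 i \<subseteq> (\<Union>j\<in>I. cell k j)"
    proof
      fix x assume x: "x \<in> S k \<inter> cell 0 i"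
      define j where "j = \<lfloor>x / width k\<rfloor>"
      have xj: "x \<in> cell k j" by (simp add: mem_grid_cell j_def)
      have "cell k j \<subseteq> cell 0 i \<or> cell 0 i \<inter> cell k j = {}"
        using cell_dichotomy_grid[of 0 k j i "i + 1"] by (simp add: grid_cell_def)
      then have "j \<in> I" using x xj cell_dichotomy_S[of k j] by (auto simp: I_def)
      with xj show "x \<in> (\<Union>j\<in>I. cell k j)" by blast
    qed
  qed (auto simp: I_def)
  then have "(\<Sum>j\<in>I. emeasure lborel (cell k j)) = emeasure lborel (S k \<inter> cell 0 i)"
    using fin disj by (subst sum_emeasure) (auto simp: disjoint_family_on_def)
  then have total: "(\<Sum>j\<in>I. emeasure lborel (cell k j)) = ennreal ((1/D) ^ k * s)"
    unfolding emeasure_chain_cell emeasure_cell using s_pos by (simp flip: ennreal_mult)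
  have "ennreal (jump powr p * s) = ennreal (jump powr p * D ^ k) * ennreal ((1/D) ^ k * s)"
    using s_pos by (simp add: power_divide flip: ennreal_mult)
  also have "\<dots> = (\<Sum>j\<in>I. ennreal (jump powr p * D ^ k) * emeasure lborel (cell k j))"
    by (simp only: sum_distrib_left flip: total)
  also have "\<dots> \<le> (\<Sum>j\<in>I. ennreal (measure lebesgue (cell k j) * mean_oscillation tower (cell k j) powr p))"
  proof (rule sum_mono)
    fix j assume "j \<in> I"
    then have "jump * H ^ k \<le> mean_oscillation tower (cell k j)"
      by (intro cell_oscillation_ge) (auto simp: I_def)
    then have "(jump * H ^ k) powr p \<le> mean_oscillation tower (cell k j) powr p"
      using p_gt_1 jump_pos H_pos by (intro powr_mono2) auto
    then have "jump powr p * D ^ k * width k \<le> mean_oscillation tower (cell k j) powr p * width k"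
      using jump_pos H_pos by (intro mult_right_mono) (auto simp: powr_mult H_powr_power)
    then show "ennreal (jump powr p * D ^ k) * emeasure lborel (cell k j)
      \<le> ennreal (measure lebesgue (cell k j) * mean_oscillation tower (cell k j) powr p)"
      by (simp add: emeasure_cell measure_cell mult.commute flip: ennreal_mult)
  qed
  also have "\<dots> = JN_sum p tower F"
    unfolding JN_sum_def F using fin inj by (simp add: infsum_finite sum.reindex)
  finally show "ennreal (jump powr p * s) \<le> JN_sum p tower F" .
qed

lemma tower_notin_VJN:
  assumes "cell 0 i \<subseteq> Q0"
  shows "tower \<notin> VJN p Q0"
proof
  assume "tower \<in> VJN p Q0"
  then have "((\<lambda>a. SUP F\<in>{F \<in> interval_collections Q0. \<forall>Q\<in>F. measure lebesgue Q \<le> a}. JN_sum p tower F)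
        \<longlongrightarrow> 0) (at_right 0)"
    by (simp add: VJN_def)
  moreover have "0 < ennreal (jump powr p * s)" using jump_pos s_pos by simp
  ultimately have "\<forall>\<^sub>F a in at_right 0. (SUP F\<in>{F \<in> interval_collections Q0. \<forall>Q\<in>F. measure lebesgue Q \<le> a}. JN_sum p tower F)
        < ennreal (jump powr p * s)"
    by (rule order_tendstoD(2))
  then obtain b :: real where b: "0 < b" "\<And>a. 0 < a \<Longrightarrow> a < b \<Longrightarrow>
      (SUP F\<in>{F \<in> interval_collections Q0. \<forall>Q\<in>F. measure lebesgue Q \<le> a}. JN_sum p tower F) < ennreal (jump powr p * s)"
    by (auto simp: eventually_at_right_field)
  obtain k where "width k < b" using ex_width_less[OF b(1)] by blast
  then have "(SUP F\<in>{F \<in> interval_collections Q0. \<forall>Q\<in>F. measure lebesgue Q \<le> width k}. JN_sum p tower F) < ennreal (jump powr p * s)"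
    by (intro b(2)) auto
  moreover have "ennreal (jump powr p * s) \<le> (SUP F\<in>{F \<in> interval_collections Q0. \<forall>Q\<in>F. measure lebesgue Q \<le> width k}. JN_sum p tower F)"
    using JN_sum_cells_ge[OF assms, of k] by (intro SUP_upper2) auto
  ultimately show False by simp
qed

end

theorem proposition4p3:
  fixes p :: real and Q0 :: "real set"
  assumes "1 < p" and "bounded_interval Q0"
  shows "\<exists>g :: real \<Rightarrow> real. g \<in> JN p Q0 - VJN p Q0"
proof -
  obtain a b where ab: "a < b" "{a<..<b} \<subseteq> Q0"
    using assms(2) by (rule bounded_interval_ends)
  \<comment> \<open>An interval of length \<open>3 * s\<close> contains a full cell of the grid \<open>s\<int>\<close> in its interior.\<close>
  define s where "s = (b - a) / 3"
  define i where "i = \<lfloor>a / s\<rfloor> + 1"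
  have s: "0 < s" using ab by (simp add: s_def)
  have i: "a < of_int i * s" "of_int i * s \<le> a + s"
    using floor_divide_upper[OF s, of a] floor_divide_lower[OF s, of a] by (auto simp: i_def algebra_simps)
  \<comment> \<open>This makes $D^{1 - 1/p} \ge 4$, which is \<open>4 * H \<le> 2 * d\<close>.\<close>
  obtain d :: nat where d: "4 powr (1 / (1 - 1/p)) < real d" using reals_Archimedean2 by blast
  define H where "H = (2 * real d) powr (1/p)"
  have p: "0 < 1 - 1/p" using assms(1) by simp
  have "0 < 4 powr (1 / (1 - 1/p))" by simp
  with d have dpos: "0 < real d" by linarith
  have "4 = (4 powr (1 / (1 - 1/p))) powr (1 - 1/p)" using p assms(1) by (auto simp: powr_powr)
  also have "\<dots> \<le> (2 * real d) powr (1 - 1/p)" using p d dpos by (intro powr_mono2) auto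
  finally have "H * 4 \<le> H * (2 * real d) powr (1 - 1/p)" by (intro mult_left_mono) (auto simp: H_def)
  also have "\<dots> = 2 * real d" using dpos by (simp add: H_def flip: powr_add)
  finally have H_le: "2 * H \<le> real d" by simp
  have "1 < H" using dpos assms(1) by (simp add: H_def)
  moreover have "H powr p = 2 * real d" using assms(1) by (simp add: H_def powr_powr)
  ultimately interpret nested_cells s H p d
    using s assms(1) H_le by unfold_locales auto
  have "grid_cell s i \<subseteq> {a<..<b}"
  proof -
    have "b = a + 3 * s" by (simp add: s_def field_simps)
    then show ?thesis using i s by (auto simp: grid_cell_def algebra_simps)
  qed
  with ab(2) have "cell 0 i \<subseteq> Q0" by simp
  then have "tower \<notin> VJN p Q0" by (rule tower_notin_VJN)
  with tower_in_JN[OF assms(2)] show ?thesis by blast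
qed

end
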